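(* Let $n\ge 3$ be an integer, let $1<p\le\infty$ and let $q$ be its conjugate exponent ($1/p+1/q=1$). Let $\alpha\in\mathbb{R}$, $\beta>0$ satisfy $n+\alpha=\beta+1$. For $\varphi\in L^{p}(\mathbb{S}^{n-1},\mathbb{R}^{n})$ let $$u_{\alpha,\beta}[\varphi](x)=c_{n,\beta}\int_{\mathbb{S}^{n-1}}\frac{(1-|x|^{2})^{\alpha}}{|x-\eta|^{\beta}}\,\varphi(\eta)\,d\sigma(\eta),\qquad x\in\mathbb{B}^n.$$ Then the inequality $$|u_{\alpha,\beta}[\varphi](x)|\le \frac{C_{p}}{(1-|x|^{2})^{(n-1)/p}}\,\|\varphi\|_{L^{p}}\qquad\text{for all } x\in\mathbb{B}^n,\ \varphi\in L^{p}(\mathbb{S}^{n-1},\mathbb{R}^{n})$$ holds, and is sharp (i.e. $C_p$ is the smallest constant for which it holds for all such $x$ and $\varphi$), with $C_p$ given as follows. If $n\le\beta<2(n-1)$, then $$C_{p}=\begin{cases} c_{n,\beta}, & \text{if } q\le \frac{2(n-1)}{\beta},\\[4pt] c_{n,\beta}\left(\dfrac{\Gamma(\frac{n}{2})\,\Gamma(q\beta-n+1)}{\Gamma(\frac{q\beta}{2})\,\Gamma(\frac{q\beta-n+2}{2})}\right)^{1/q}, & \text{if } q>\frac{2(n-1)}{\beta}.\end{cases}$$ If $\beta\ge 2(n-1)$, then $$C_{p}=c_{n,\beta}\left(\frac{\Gamma(\frac{n}{2})\,\Gamma(q\beta-n+1)}{\Gamma(\frac{q\beta}{2})\,\Ga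mma(\frac{q\beta-n+2}{2})}\right)^{1/q}.$$
   Context: $\mathbb{B}^n$ is the open unit ball of $\mathbb{R}^n$ with Euclidean norm $|\cdot|$, $\mathbb{S}^{n-1}$ its boundary sphere, and $\sigma$ the surface measure on $\mathbb{S}^{n-1}$ normalized so that $\sigma(\mathbb{S}^{n-1})=1$; $\|\varphi\|_{L^p}=\left(\int_{\mathbb{S}^{n-1}}|\varphi|^p\,d\sigma\right)^{1/p}$ (essential supremum if $p=\infty$). The constant is $c_{n,\beta}=\frac{\Gamma(\frac{\beta}{2})\Gamma(\frac{\beta}{2}-\frac{n}{2}+1)}{\Gamma(\frac{n}{2})\Gamma(\beta-n+1)}$, and $\Gamma$ is the Gamma function. *)

theory Defs
  imports "HOL-Analysis.Analysis" "HOL-Probability.Essential_Supremum"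
begin

text \<open>Normalized surface measure on the unit sphere of \<open>real^'n\<close>:
  sigma(A) = Lebesgue measure of the cone {t x | 0 < t <= 1, x in A} divided by
  the volume of the unit ball (so that sigma(sphere) = 1).\<close>
definition sphere_measure :: "('n::finite) itself \<Rightarrow> (real^'n) measure" where
  "sphere_measure _ = measure_of (sphere 0 1) (sets (restrict_space borel (sphere (0::real^'n) 1)))
     (\<lambda>A. emeasure lborel {t *\<^sub>R x | t x. 0 < t \<and> t \<le> 1 \<and> x \<in> A}
          / emeasure lborel (ball (0::real^'n) 1))"

definition inv_exp :: "ereal \<Rightarrow> real" where
  "inv_exp p = (if p = \<infinity> then 0 else 1 / real_of_ereal p)"

definition conj_exp :: "ereal \<Rightarrow> real" where
  "conj_exp p = (if p = \<infinity> then 1 else real_of_ereal p / (real_of_ereal p - 1))"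

definition in_Lp :: "'n::finite itself \<Rightarrow> ereal \<Rightarrow> (real^'n \<Rightarrow> real^'n) \<Rightarrow> bool" where
  "in_Lp N p \<phi> \<longleftrightarrow> \<phi> \<in> borel_measurable (sphere_measure N) \<and>
     (if p = \<infinity> then esssup (sphere_measure N) (\<lambda>\<eta>. ereal (norm (\<phi> \<eta>))) < \<infinity>
      else integrable (sphere_measure N) (\<lambda>\<eta>. norm (\<phi> \<eta>) powr real_of_ereal p))"

definition Lp_norm :: "'n::finite itself \<Rightarrow> ereal \<Rightarrow> (real^'n \<Rightarrow> real^'n) \<Rightarrow> real" where
  "Lp_norm N p \<phi> = (if p = \<infinity> then real_of_ereal (esssup (sphere_measure N) (\<lambda>\<eta>. ereal (norm (\<phi> \<eta>))))
      else (integral\<^sup>L (sphere_measure N) (\<lambda>\<eta>. norm (\<phi> \<eta>) powr real_of_ereal p))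
             powr (1 / real_of_ereal p))"

definition c_const :: "real \<Rightarrow> real \<Rightarrow> real" where
  "c_const n \<beta> = Gamma (\<beta>/2) * Gamma (\<beta>/2 - n/2 + 1) / (Gamma (n/2) * Gamma (\<beta> - n + 1))"

definition u_ab :: "'n::finite itself \<Rightarrow> real \<Rightarrow> real \<Rightarrow> (real^'n \<Rightarrow> real^'n) \<Rightarrow> real^'n \<Rightarrow> real^'n" where
  "u_ab N \<alpha> \<beta> \<phi> x = c_const (real CARD('n)) \<beta> *\<^sub>R
     integral\<^sup>L (sphere_measure N)
       (\<lambda>\<eta>. ((1 - norm x ^ 2) powr \<alpha> / norm (x - \<eta>) powr \<beta>) *\<^sub>R \<phi> \<eta>)"

definition bound_holds :: "'n::finite itself \<Rightarrow> real \<Rightarrow> real \<Rightarrow> ereal \<Rightarrow> real \<Rightarrow> bool" where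
  "bound_holds N \<alpha> \<beta> p C \<longleftrightarrow> (\<forall>x\<in>ball (0::real^'n) 1. \<forall>\<phi>. in_Lp N p \<phi> \<longrightarrow>
      norm (u_ab N \<alpha> \<beta> \<phi> x)
        \<le> C / (1 - norm x ^ 2) powr ((real CARD('n) - 1) * inv_exp p) * Lp_norm N p \<phi>)"

definition C_p :: "real \<Rightarrow> real \<Rightarrow> real \<Rightarrow> real" where
  "C_p n \<beta> q =
     (if n \<le> \<beta> \<and> \<beta> < 2*(n-1) \<and> q \<le> 2*(n-1)/\<beta> then c_const n \<beta>
      else c_const n \<beta> * (Gamma (n/2) * Gamma (q*\<beta> - n + 1)
              / (Gamma (q*\<beta>/2) * Gamma ((q*\<beta> - n + 2)/2))) powr (1/q))"

end

(*
  By Hoelder's inequality and its equality case, the best constant for a fixed x is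
  c * (T_s x)^(1/q), where s = q * beta and
    T_s x = (1 - |x|^2)^(s - n + 1) * integral of |x - eta|^(-s) over the sphere.
  The integrand depends on the angle between x and eta only, so T_s x is a one-dimensional
  integral against the weight (1 - t^2)^((n-3)/2), and the conformal involution of the sphere
  determined by x, which acts on t by a rational substitution, turns it into
  J_k(r) / J_k(0) with r = |x|, k = s/2 - n + 1 and
    J_k(r) = integral of (1 - 2 r t + r^2)^k (1 - t^2)^((n-3)/2) over [-1, 1].
  One computes J_k' = (k/r) (J_k - (1 - r^2) J_(k-1)). Symmetrising J_k and J_(k-1) under the
  involution reduces J_k >= (1 - r^2) J_(k-1) to the monotonicity of cosh, which applies for
  k >= 1 - n/2, that is for s >= n. Hence T_s is largest at the centre for s <= 2 (n - 1), and
  tends to its supremum at the boundary, a Beta integral, for s >= 2 (n - 1).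
*)
theory Submission
  imports Defs "HOL-Probability.Distributions"
begin

section \<open>One-dimensional integrals\<close>

text \<open>The measure sigma is defined by volumes of cones, which says nothing directly about
  slices orthogonal to x. The slicing formula is obtained from moments: polar coordinates split the
  Gaussian moments of the component of y along a unit vector v into a radial factor and the moments
  of sigma, completing a square gives their generating function, and comparing power series gives
  the even moments. They match the moments of the weight, and approximation by polynomials does the
  rest. The involution is decisive because it inverts u = |x - eta|^2 / (1 - |x|^2), so that
  averaging over it turns powers of u into cosh of multiples of ln u. The exponents -s/2 and k are
  exchanged because they sum to -(n - 1). Working with k is better: the singular power of 1 - |x|^2
  is split off, and the sign of k separates the two regimes, with J_k independent of r for k =
  0.\<close>

definition sq_dist :: "real \<Rightarrow> real \<Rightarrow> real" where
  "sq_dist r t = 1 - 2 * r * t + r\<^sup>2"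

text \<open>\<open>d\<close> stands for \<open>n - 3\<close>; the natural exponent keeps the weight continuous at \<open>\<plusminus>1\<close>
  also for \<open>d = 0\<close>, since \<open>0 ^ 0 = 1\<close> whereas \<open>0 powr 0 = 0\<close>.\<close>
definition zonal_int :: "nat \<Rightarrow> real \<Rightarrow> real \<Rightarrow> real" where
  "zonal_int d k r = integral {-1..1} (\<lambda>t. sq_dist r t powr k * sqrt (1 - t\<^sup>2) ^ d)"

lemma sq_dist_ge: 
  assumes "0 \<le> r" "t \<in> {-1..1}" shows "(1 - r)\<^sup>2 \<le> sq_dist r t"
proof -
  have "r * t \<le> r * 1" using assms by (intro mult_left_mono) auto
  then show ?thesis by (simp add: sq_dist_def power2_eq_square algebra_simps)
qed

lemma sq_dist_pos: "0 \<le> r \<Longrightarrow> r < 1 \<Longrightarrow> t \<in> {-1..1} \<Longrightarrow> 0 < sq_dist r t"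
  using sq_dist_ge[of r t] zero_less_power2[of "1 - r"] by linarith

lemma sq_dist_nonneg: "0 \<le> r \<Longrightarrow> t \<in> {-1..1} \<Longrightarrow> 0 \<le> sq_dist r t"
  using sq_dist_ge[of r t] zero_le_power2[of "1 - r"] by linarith

lemma continuous_on_sq_dist_powr:
  assumes "0 \<le> r" "r < 1"
  shows "continuous_on {-1..1} (\<lambda>t. sq_dist r t powr k)"
proof (intro continuous_on_powr continuous_on_const)
  show "continuous_on {-1..1} (sq_dist r)"
    unfolding sq_dist_def by (intro continuous_intros)
qed (use assms sq_dist_pos in force)

lemma zonal_integrable:
  assumes "0 \<le> r" "r < 1"
  shows "(\<lambda>t. sq_dist r t powr k * sqrt (1 - t\<^sup>2) ^ d) integrable_on {-1..1}"
  by (intro integrable_continuous_real continuous_on_mult continuous_on_sq_dist_powr assms continuous_intros)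

lemma zonal_int_nonneg: "0 \<le> zonal_int d k r"
\<comment> \<open>A non-integrable function has integral 0, so the bound also covers
  \<open>r = 1\<close> for any \<open>k\<close>.\<close>
proof (cases "(\<lambda>t. sq_dist r t powr k * sqrt (1 - t\<^sup>2) ^ d) integrable_on {-1..1}")
  case True
  then show ?thesis unfolding zonal_int_def
    by (intro integral_nonneg) (auto simp: abs_square_le_1 abs_le_iff)
qed (simp add: zonal_int_def not_integrable_integral)

text \<open>At the centre all distances are 1 and the exponent disappears. This is why the
  normalising constant is written \<open>zonal_int d 0 0\<close> for every exponent.\<close>

lemma zonal_int_at_0: "zonal_int d k 0 = zonal_int d 0 0"
  unfolding zonal_int_def by (simp add: sq_dist_def)

text \<open>The substitution \<open>g\<close> turns the squared distance \<open>E\<close> into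
  \<open>\<rho>\<^sup>2 / E\<close>, multiplies \<open>sqrt (1 - t\<^sup>2)\<close> by
  \<open>\<rho> / E\<close>, and has a derivative of modulus \<open>(\<rho> / E)\<^sup>2\<close>.
  These \<open>d + 2\<close> factors \<open>\<rho> / E\<close> account for both exponents on the
  right.\<close>

lemma zonal_int_Mobius:
  assumes r: "0 < r" "r < 1"
  shows "zonal_int d k r = (1 - r\<^sup>2) powr (2 * k + d + 2) * zonal_int d (- k - (real d + 2)) r"
proof -
  define \<rho> where "\<rho> = 1 - r\<^sup>2"
  have \<rho>: "\<rho> > 0" using r by (simp add: \<rho>_def abs_square_less_1)
  \<comment> \<open>\<open>g\<close> is chosen so that \<open>sq_dist r (g t) * sq_dist r t = (1 - r\<^sup>2)\<^sup>2\<close>.\<close>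
  define g where "g t = (1 + r\<^sup>2 - \<rho>\<^sup>2 / sq_dist r t) / (2 * r)" for t
  define f where "f t = sq_dist r t powr k * sqrt (1 - t\<^sup>2) ^ d" for t
  have D: "sq_dist r t > 0" if "t \<in> {-1..1}" for t using sq_dist_pos r that by auto
  have Dg: "sq_dist r (g t) = \<rho>\<^sup>2 / sq_dist r t" for t
    unfolding g_def sq_dist_def using r by simp
  have g1: "1 - (g t)\<^sup>2 = \<rho>\<^sup>2 * (1 - t\<^sup>2) / (sq_dist r t)\<^sup>2" if t: "t \<in> {-1..1}" for t
  proof -
    define D where "D = sq_dist r t"
    have D0: "D \<noteq> 0" using D[OF t] by (simp add: D_def)
    \<comment> \<open>With \<open>t\<close> expressed through \<open>D\<close>, the claim becomes a
      polynomial identity in \<open>D\<close> and \<open>r\<close>.\<close>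
    have tt: "t = (1 + r\<^sup>2 - D) / (2 * r)" using r by (simp add: D_def sq_dist_def)
    have "4 * r\<^sup>2 * D\<^sup>2 * (1 - (g t)\<^sup>2) = 4 * r\<^sup>2 * D\<^sup>2 - ((1 + r\<^sup>2) * D - \<rho>\<^sup>2)\<^sup>2"
      using r D0 unfolding g_def D_def[symmetric] by (simp add: field_simps power2_eq_square)
    also have "\<dots> = \<rho>\<^sup>2 * (4 * r\<^sup>2 - (1 + r\<^sup>2 - D)\<^sup>2)"
      unfolding \<rho>_def by algebra
    also have "\<dots> = 4 * r\<^sup>2 * (\<rho>\<^sup>2 * (1 - t\<^sup>2))"
      unfolding tt using r by (simp add: field_simps power2_eq_square)
    finally have "D\<^sup>2 * (1 - (g t)\<^sup>2) = \<rho>\<^sup>2 * (1 - t\<^sup>2)" using r by simp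
    then show ?thesis using D0 unfolding D_def by (simp add: field_simps)
  qed
  have fz: "zonal_int d k r = integral {-1..1} f"
    unfolding zonal_int_def f_def ..
  have gr: "g ` {-1..1} \<subseteq> {-1..1}"
  proof clarify
    fix t :: real assume "t \<in> {-1..1}"
    then have "1 - (g t)\<^sup>2 \<ge> 0" by (subst g1) (auto simp: abs_square_le_1 abs_le_iff)
    then have "\<bar>g t\<bar> \<le> 1" by (simp add: abs_square_le_1)
    then show "g t \<in> {-1..1}" by (simp add: abs_le_iff)
  qed
  have gm1: "g (-1) = 1" and gp1: "g 1 = -1"
  proof -
    have *: "sq_dist r (-1) = (1+r)\<^sup>2" "sq_dist r 1 = (1-r)\<^sup>2" 
      by (simp_all add: sq_dist_def power2_eq_square algebra_simps)
    have "\<rho>\<^sup>2 = (1+r)\<^sup>2*(1-r)\<^sup>2" unfolding \<rho>_def by algebra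
    then have "\<rho>\<^sup>2 / sq_dist r (-1) = (1-r)\<^sup>2" "\<rho>\<^sup>2 / sq_dist r 1 = (1+r)\<^sup>2"
      unfolding * using r by simp_all
    then show "g (-1) = 1" "g 1 = -1" using r unfolding g_def
      by (simp_all add: power2_eq_square field_simps)
  qed
  have gder: "(g has_field_derivative (- \<rho>\<^sup>2 / (sq_dist r t)\<^sup>2)) (at t within {-1..1})" if t: "t \<in> {-1..1}" for t
  proof -
    have "(sq_dist r has_field_derivative - (2 * r)) (at t within {-1..1})"
      unfolding sq_dist_def by (auto intro!: derivative_eq_intros)
    then show ?thesis unfolding g_def using r D[OF t]
      by (auto intro!: derivative_eq_intros simp: power2_eq_square)
  qed
  have fc: "continuous_on {-1..1} f"
    unfolding f_def using r by (intro continuous_on_mult continuous_on_sq_dist_powr continuous_intros) auto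
  \<comment> \<open>\<open>g\<close> reverses the interval: the first oriented integral is over an
    empty interval, the second over \<open>{-1..1}\<close>, and its sign cancels that of the
    derivative.\<close>
  have "((\<lambda>t. (- \<rho>\<^sup>2 / (sq_dist r t)\<^sup>2) *\<^sub>R f (g t)) has_integral (integral {g (-1)..g 1} f - integral {g 1..g (-1)} f)) {-1..1}"
    using gder gr by (intro has_integral_substitution_general[where s="{}" and c="-1" and d=1] fc DERIV_continuous_on[OF gder]) auto
  then have "((\<lambda>t. (- \<rho>\<^sup>2 / (sq_dist r t)\<^sup>2) *\<^sub>R f (g t)) has_integral (- zonal_int d k r)) {-1..1}"
    unfolding gm1 gp1 by (simp add: fz)
  then have "((\<lambda>t. (\<rho>\<^sup>2 / (sq_dist r t)\<^sup>2) * f (g t)) has_integral zonal_int d k r) {-1..1}"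
    by (drule_tac has_integral_neg) simp
  then have "zonal_int d k r = integral {-1..1} (\<lambda>t. (\<rho>\<^sup>2 / (sq_dist r t)\<^sup>2) * f (g t))"
    by (simp add: integral_unique)
  also have "\<dots> = integral {-1..1} (\<lambda>t. \<rho> powr (2 * k + d + 2) * (sq_dist r t powr (- k - (real d + 2)) * sqrt (1 - t\<^sup>2) ^ d))"
  proof (rule integral_cong)
    fix t :: real assume t: "t \<in> {-1..1}"
    define E where "E = sq_dist r t"
    have E: "E > 0" using D t E_def by simp
    have "sqrt (1 - (g t)\<^sup>2) = \<rho> * sqrt (1 - t\<^sup>2) / E"
      unfolding g1[OF t] E_def[symmetric] using \<rho> E by (simp add: real_sqrt_divide real_sqrt_mult)
    then have "f (g t) = (\<rho>\<^sup>2 / E) powr k * (\<rho> * sqrt (1 - t\<^sup>2) / E) ^ d"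
      unfolding f_def Dg E_def by simp
    also have "(\<rho>\<^sup>2 / E) powr k = \<rho> powr (2*k) * E powr (-k)"
    proof -
      have "\<rho>\<^sup>2 = \<rho> powr 2" using \<rho> by simp
      then show ?thesis using E \<rho> by (simp only: powr_divide powr_powr powr_ge_zero) (simp add: powr_minus_divide)
    qed
    also have "(\<rho> * sqrt (1 - t\<^sup>2) / E) ^ d = \<rho> powr d * sqrt (1 - t\<^sup>2) ^ d * E powr (- real d)"
      using E \<rho> by (simp add: power_mult_distrib power_divide powr_realpow powr_minus_divide)
    finally have *: "f (g t) = \<rho> powr (2*k) * E powr (-k) * (\<rho> powr d * sqrt (1 - t\<^sup>2) ^ d * E powr (- real d))" .
    have "\<rho>\<^sup>2 / E\<^sup>2 = \<rho> powr 2 * E powr (-2)" using \<rho> E by (simp add: powr_minus_divide)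
    then show "(\<rho>\<^sup>2 / (sq_dist r t)\<^sup>2) * f (g t) = \<rho> powr (2 * k + d + 2) * (sq_dist r t powr (- k - (real d + 2)) * sqrt (1 - t\<^sup>2) ^ d)"
      unfolding * E_def[symmetric] by (simp add: powr_add powr_diff powr_minus_divide mult_ac)
  qed
  also have "\<dots> = \<rho> powr (2 * k + d + 2) * zonal_int d (- k - (real d + 2)) r"
    unfolding zonal_int_def by (subst integral_mult_right) simp_all
  finally show ?thesis unfolding \<rho>_def .
qed

section \<open>Monotonicity of the zonal integral in the radius\<close>

lemma powr_sym_mono:
  fixes u a b :: real
  assumes "u > 0" "\<bar>a\<bar> \<le> b"
  shows "u powr a + u powr (- a) \<le> u powr b + u powr (- b)"
proof -
  \<comment> \<open>Each sum is twice a cosh, which is even and increasing on the nonnegative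
    axis.\<close>
  have "cosh (a * ln u) \<le> cosh (b * ln u)"
  proof -
    have "cosh \<bar>a * ln u\<bar> \<le> cosh \<bar>b * ln u\<bar>"
      using assms by (subst cosh_real_nonneg_le_iff) (auto simp: abs_mult mult_right_mono)
    then show ?thesis by simp
  qed
  then show ?thesis using assms by (simp add: cosh_def powr_def exp_minus)
qed

text \<open>Put u = \<open>sq_dist r t / (1 - r\<^sup>2)\<close>, which the involution sends to 1/u.
  Adding to each integral its transform, both integrands become one positive factor times u^a +
  u^(-a), with a = \<open>m - 1\<close> on the left and a = \<open>m\<close> on the right.\<close>

lemma zonal_int_ineq:
  assumes r: "0 < r" "r < 1" and k: "k \<ge> - (real d + 1) / 2"
  shows "(1 - r\<^sup>2) * zonal_int d (k - 1) r \<le> zonal_int d k r"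
proof -
  define \<rho> where "\<rho> = 1 - r\<^sup>2"
  have \<rho>: "\<rho> > 0" using r by (simp add: \<rho>_def abs_square_less_1)
  \<comment> \<open>The involution sends \<open>k\<close> to \<open>- k - (d + 2)\<close>;
    \<open>m\<close> is the offset of \<open>k\<close> from the fixed point
    \<open>- (d + 2) / 2\<close>.\<close>
  define m where "m = k + (real d + 2) / 2"
  define S where "S a t = sq_dist r t powr (- (real d + 2) / 2) * \<rho> powr m *
     ((sq_dist r t / \<rho>) powr a + (sq_dist r t / \<rho>) powr (- a)) * sqrt (1 - t\<^sup>2) ^ d" for a t
  have D: "sq_dist r t > 0" if "t \<in> {-1..1}" for t using sq_dist_pos r that by auto
  have int: "(\<lambda>t. sq_dist r t powr k * sqrt (1 - t\<^sup>2) ^ d) integrable_on {-1..1}" for k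
    using r by (intro zonal_integrable) auto
  \<comment> \<open>\<open>j = 0\<close> gives twice the right-hand side and \<open>j = 1\<close>
    twice the left-hand side; the factor \<open>\<rho> powr j\<close> makes the prefactor in
    \<open>S\<close> independent of \<open>j\<close>.\<close>
  have S: "(S (m - j) has_integral 2 * \<rho> powr j * zonal_int d (k - j) r) {-1..1}" for j
  proof -
    have "zonal_int d (k - j) r = \<rho> powr (2 * (k - j) + d + 2) * zonal_int d (- (k - j) - (real d + 2)) r"
      unfolding \<rho>_def using r by (intro zonal_int_Mobius)
    then have "2 * \<rho> powr j * zonal_int d (k - j) r = \<rho> powr j * zonal_int d (k - j) r
        + (\<rho> powr j * \<rho> powr (2 * (k - j) + d + 2)) * zonal_int d (- (k - j) - (real d + 2)) r"
      by simp
    moreover have "((\<lambda>t. \<rho> powr j * (sq_dist r t powr (k - j) * sqrt (1 - t\<^sup>2) ^ d) 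
        + (\<rho> powr j * \<rho> powr (2 * (k - j) + d + 2)) * (sq_dist r t powr (- (k - j) - (real d + 2)) * sqrt (1 - t\<^sup>2) ^ d)) has_integral
       (\<rho> powr j * zonal_int d (k - j) r
        + (\<rho> powr j * \<rho> powr (2 * (k - j) + d + 2)) * zonal_int d (- (k - j) - (real d + 2)) r)) {-1..1}"
      unfolding zonal_int_def by (intro has_integral_add has_integral_mult_right integrable_integral int)
    ultimately have "((\<lambda>t. \<rho> powr j * (sq_dist r t powr (k - j) * sqrt (1 - t\<^sup>2) ^ d) 
        + (\<rho> powr j * \<rho> powr (2 * (k - j) + d + 2)) * (sq_dist r t powr (- (k - j) - (real d + 2)) * sqrt (1 - t\<^sup>2) ^ d)) has_integral
       2 * \<rho> powr j * zonal_int d (k - j) r) {-1..1}" by (simp only:)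
    then show ?thesis
    proof (rule has_integral_eq[rotated])
      fix t :: real assume t: "t \<in> {-1..1}"
      define E where "E = sq_dist r t"
      have E: "E > 0" using D t E_def by simp
      have "E powr (- (real d + 2) / 2) * \<rho> powr m * (E / \<rho>) powr (m - j) = \<rho> powr j * E powr (k - j)"
      proof -
        have "E powr (- (real d + 2) / 2) * \<rho> powr m * (E / \<rho>) powr (m - j) 
          = (E powr (- (real d + 2) / 2) * E powr (m - j)) * (\<rho> powr m * \<rho> powr (- (m - j)))"
          using \<rho> E unfolding powr_minus by (simp add: powr_divide field_simps)
        also have "\<dots> = E powr (k - j) * \<rho> powr j"
        proof -
          have "- (real d + 2) / 2 + (m - j) = k - j" "m + - (m - j) = j" by (simp_all add: m_def field_simps)
          then show ?thesis unfolding powr_add[symmetric] by (simp only:)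
        qed
        finally show ?thesis by simp
      qed
      moreover have "E powr (- (real d + 2) / 2) * \<rho> powr m * (E / \<rho>) powr (- (m - j)) = \<rho> powr j * \<rho> powr (2 * (k - j) + d + 2) * E powr (- (k - j) - (real d + 2))"
      proof -
        have "E powr (- (real d + 2) / 2) * \<rho> powr m * (E / \<rho>) powr (- (m - j)) 
          = (E powr (- (real d + 2) / 2) * E powr (- (m - j))) * (\<rho> powr m * \<rho> powr (m - j))"
          using \<rho> E unfolding powr_minus by (simp add: powr_divide field_simps)
        also have "\<dots> = E powr (- (k - j) - (real d + 2)) * (\<rho> powr j * \<rho> powr (2 * (k - j) + d + 2))"
        proof -
          have "- (real d + 2) / 2 + - (m - j) = - (k - j) - (real d + 2)" "m + (m - j) = j + (2 * (k - j) + d + 2)"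
            by (simp_all add: m_def field_simps)
          then show ?thesis unfolding powr_add[symmetric] by (simp only:)
        qed
        finally show ?thesis by simp
      qed
      ultimately show "\<rho> powr j * (sq_dist r t powr (k - j) * sqrt (1 - t\<^sup>2) ^ d) 
        + (\<rho> powr j * \<rho> powr (2 * (k - j) + d + 2)) * (sq_dist r t powr (- (k - j) - (real d + 2)) * sqrt (1 - t\<^sup>2) ^ d) = S (m - j) t"
        unfolding S_def E_def[symmetric] by (simp add: algebra_simps)
    qed
  qed
  have "2 * \<rho> powr 1 * zonal_int d (k - 1) r \<le> 2 * \<rho> powr 0 * zonal_int d (k - 0) r"
  proof (rule has_integral_le[OF S S])
    fix t :: real assume t: "t \<in> {-1..1}"
    \<comment> \<open>This says \<open>m \<ge> 1 / 2\<close>, which is the hypothesis on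
      \<open>k\<close>.\<close>
    have "\<bar>m - 1\<bar> \<le> m - 0" using k by (simp add: m_def abs_le_iff field_simps)
    then show "S (m - 1) t \<le> S (m - 0) t" unfolding S_def using t D[OF t] \<rho>
      by (intro mult_right_mono mult_left_mono powr_sym_mono) (auto simp: abs_square_le_1 abs_le_iff)
  qed
  then show ?thesis using \<rho> by (simp add: \<rho>_def)
qed

text \<open>The inner derivative \<open>2 * r - 2 * t\<close> equals
  \<open>(sq_dist r t - (1 - r\<^sup>2)) / r\<close>; its first term raises the exponent
  \<open>k - 1\<close> back to \<open>k\<close>, the second keeps it.\<close>

lemma zonal_int_deriv:
  assumes r: "0 < r" "r < 1"
  shows "((\<lambda>r. zonal_int d k r) has_real_derivative k / r * (zonal_int d k r - (1 - r\<^sup>2) * zonal_int d (k - 1) r)) (at r)"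
proof -
  have D: "sq_dist r t > 0" if "t \<in> {-1..1}" "r \<in> {0<..<1}" for r t using sq_dist_pos that by auto
  have "((\<lambda>r. integral (cbox (-1) 1) (\<lambda>t. sq_dist r t powr k * sqrt (1 - t\<^sup>2) ^ d)) has_field_derivative
     integral (cbox (-1) 1) (\<lambda>t. k * sq_dist r t powr (k - 1) * (2 * r - 2 * t) * sqrt (1 - t\<^sup>2) ^ d)) (at r within {0<..<1})"
  proof (rule leibniz_rule_field_derivative)
    fix r t :: real assume "r \<in> {0<..<1}" "t \<in> cbox (-1) 1"
    with D[of t r] show "((\<lambda>r. sq_dist r t powr k * sqrt (1 - t\<^sup>2) ^ d) has_field_derivative
       k * sq_dist r t powr (k - 1) * (2 * r - 2 * t) * sqrt (1 - t\<^sup>2) ^ d) (at r within {0<..<1})"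
      unfolding sq_dist_def by (auto intro!: derivative_eq_intros simp: powr_diff field_simps)
  next
    fix r :: real assume "r \<in> {0<..<1}"
    then show "(\<lambda>t. sq_dist r t powr k * sqrt (1 - t\<^sup>2) ^ d) integrable_on cbox (-1) 1"
      using zonal_integrable by auto
  next
    have "continuous_on ({0<..<1} \<times> cbox (-1) 1) (\<lambda>x. k * sq_dist (fst x) (snd x) powr (k - 1) * (2 * fst x - 2 * snd x) * sqrt (1 - (snd x)\<^sup>2) ^ d)"
      unfolding sq_dist_def
      by (intro continuous_intros) (use D in \<open>force simp: sq_dist_def\<close>)
    then show "continuous_on ({0<..<1} \<times> cbox (-1) 1) (\<lambda>(r, t). k * sq_dist r t powr (k - 1) * (2 * r - 2 * t) * sqrt (1 - t\<^sup>2) ^ d)"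
      by (simp add: case_prod_unfold)
  qed (use r in auto)
  moreover have "integral (cbox (-1) 1) (\<lambda>t. k * sq_dist r t powr (k - 1) * (2 * r - 2 * t) * sqrt (1 - t\<^sup>2) ^ d)
     = k / r * (zonal_int d k r - (1 - r\<^sup>2) * zonal_int d (k - 1) r)" (is "?L = _")
  proof -
    have "?L = integral {-1..1} (\<lambda>t. k / r * (sq_dist r t powr k * sqrt (1 - t\<^sup>2) ^ d - (1 - r\<^sup>2) * (sq_dist r t powr (k - 1) * sqrt (1 - t\<^sup>2) ^ d)))"
      unfolding cbox_interval
    proof (rule integral_cong)
      fix t :: real assume t: "t \<in> {-1..1}"
      have *: "sq_dist r t powr k = sq_dist r t powr (k - 1) * sq_dist r t"
        using D[OF t, of r] r by (simp add: powr_diff)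
      have **: "2 * r - 2 * t = (sq_dist r t - (1 - r\<^sup>2)) / r" using r by (simp add: sq_dist_def field_simps power2_eq_square)
      show "k * sq_dist r t powr (k - 1) * (2 * r - 2 * t) * sqrt (1 - t\<^sup>2) ^ d = k / r * (sq_dist r t powr k * sqrt (1 - t\<^sup>2) ^ d - (1 - r\<^sup>2) * (sq_dist r t powr (k - 1) * sqrt (1 - t\<^sup>2) ^ d))"
        unfolding * ** by (simp add: algebra_simps diff_divide_distrib add_divide_distrib)
    qed
    also have "\<dots> = k / r * (zonal_int d k r - (1 - r\<^sup>2) * zonal_int d (k - 1) r)"
    proof (rule integral_unique)
      show "((\<lambda>t. k / r * (sq_dist r t powr k * sqrt (1 - t\<^sup>2) ^ d - (1 - r\<^sup>2) * (sq_dist r t powr (k - 1) * sqrt (1 - t\<^sup>2) ^ d))) has_integral (k / r * (zonal_int d k r - (1 - r\<^sup>2) * zonal_int d (k - 1) r))) {-1..1}"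
        unfolding zonal_int_def using r by (intro has_integral_mult_right has_integral_diff integrable_integral zonal_integrable) auto
    qed
    finally show ?thesis .
  qed
  moreover have "at r within {0<..<1} = at r" using r by (intro at_within_open) auto
  ultimately show ?thesis unfolding zonal_int_def[abs_def] by (simp add: cbox_interval)
qed

lemma continuous_on_zonal_int: "continuous_on {0..<1} (zonal_int d k)"
proof -
  have "continuous_on ({0..<1} \<times> cbox (-1) 1) (\<lambda>x. sq_dist (fst x) (snd x) powr k * sqrt (1 - (snd x)\<^sup>2) ^ d)"
    unfolding sq_dist_def
    by (intro continuous_intros) (use sq_dist_pos in \<open>force simp: sq_dist_def\<close>)
  then have "continuous_on {0..<1} (\<lambda>r. integral (cbox (-1) 1) (\<lambda>t. sq_dist r t powr k * sqrt (1 - t\<^sup>2) ^ d))"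
    by (intro integral_continuous_on_param) (simp add: case_prod_unfold)
  then show ?thesis unfolding zonal_int_def[abs_def] by (simp add: cbox_interval)
qed

text \<open>The distance vanishes at \<open>r = t = 1\<close>; a positive exponent keeps the
  integrand continuous there, with value \<open>0 powr k = 0\<close>.\<close>

lemma continuous_on_zonal_int':
  assumes "k > 0" shows "continuous_on {0..1} (zonal_int d k)"
proof -
  have "continuous_on ({0..1} \<times> cbox (-1) 1) (\<lambda>x. sq_dist (fst x) (snd x) powr k * sqrt (1 - (snd x)\<^sup>2) ^ d)"
  proof (intro continuous_on_mult continuous_on_powr')
    show "\<forall>x\<in>{0..1} \<times> cbox (- 1) 1. 0 \<le> sq_dist (fst x) (snd x) \<and> (sq_dist (fst x) (snd x) = 0 \<longrightarrow> 0 < k)"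
      using assms sq_dist_nonneg by auto
  qed (auto simp: sq_dist_def intro!: continuous_intros)
  then have "continuous_on {0..1} (\<lambda>r. integral (cbox (-1) 1) (\<lambda>t. sq_dist r t powr k * sqrt (1 - t\<^sup>2) ^ d))"
    by (intro integral_continuous_on_param) (simp add: case_prod_unfold)
  then show ?thesis unfolding zonal_int_def[abs_def] by (simp add: cbox_interval)
qed

text \<open>By \<open>zonal_int_ineq\<close> the bracket in \<open>zonal_int_deriv\<close> is
  nonnegative, so the sign of the derivative is decided by that of \<open>k\<close>.\<close>

lemma zonal_int_antimono:
  assumes k: "- (real d + 1) / 2 \<le> k" "k \<le> 0" and r: "0 \<le> r" "r < 1"
  shows "zonal_int d k r \<le> zonal_int d 0 0"
proof -
  have "zonal_int d k r \<le> zonal_int d k 0"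
  proof (rule DERIV_nonpos_imp_decreasing_open[OF r(1)])
    fix x assume x: "0 < x" "x < r"
    then have "k / x * (zonal_int d k x - (1 - x\<^sup>2) * zonal_int d (k - 1) x) \<le> 0"
      using zonal_int_ineq[of x d k] k r by (intro mult_nonpos_nonneg divide_nonpos_pos) auto
    then show "\<exists>y. (zonal_int d k has_real_derivative y) (at x) \<and> y \<le> 0"
      using zonal_int_deriv[of x d k] r x by (intro exI conjI) auto
  next
    show "continuous_on {0..r} (zonal_int d k)"
      using r by (intro continuous_on_subset[OF continuous_on_zonal_int]) auto
  qed
  then show ?thesis using zonal_int_at_0[of d k] by linarith
qed

text \<open>The derivative is known only for radii below 1; continuity up to 1 carries the
  monotonicity to the endpoint.\<close>

lemma zonal_int_le_1:
  assumes k: "0 < k" and r: "0 \<le> r" "r < 1"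
  shows "zonal_int d k r \<le> zonal_int d k 1"
proof (rule DERIV_nonneg_imp_increasing_open[of r 1])
  show "r \<le> 1" using r by simp
  show "continuous_on {r..1} (zonal_int d k)"
    using r by (intro continuous_on_subset[OF continuous_on_zonal_int'[OF k]]) auto
  fix x assume x: "r < x" "x < 1"
  have "- (real d + 1) / 2 \<le> k" using k of_nat_0_le_iff[of d] by (simp add: field_simps)
  then have "0 \<le> k / x * (zonal_int d k x - (1 - x\<^sup>2) * zonal_int d (k - 1) x)"
    using zonal_int_ineq[of x d k] k r x by simp
  then show "\<exists>y. (zonal_int d k has_real_derivative y) (at x) \<and> 0 \<le> y"
    using zonal_int_deriv[of x d k] r x by (intro exI conjI) auto
qed

section \<open>Boundary values as Gamma quotients\<close>

lemma Gamma_duplication_real: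
  fixes x :: real
  assumes "x > 0"
  shows "Gamma x * Gamma (x + 1/2) = 2 powr (1 - 2 * x) * sqrt pi * Gamma (2 * x)"
proof -
  have ni: "complex_of_real y \<notin> \<int>\<^sub>\<le>\<^sub>0" if "y > 0" for y
    using that by (auto elim!: nonpos_Ints_cases simp: complex_eq_iff)
  have "complex_of_real (Gamma x * Gamma (x + 1/2)) = Gamma (of_real x) * Gamma (of_real x + 1/2)"
    by (simp flip: Gamma_complex_of_real)
  also have "\<dots> = exp ((1 - 2 * of_real x) * of_real (ln 2)) * of_real (sqrt pi) * Gamma (2 * of_real x)"
    using ni[of x] ni[of "x + 1/2"] assms by (intro Gamma_legendre_duplication) auto
  also have "\<dots> = complex_of_real (2 powr (1 - 2 * x) * sqrt pi * Gamma (2 * x))"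
  proof -
    have "exp ((1 - 2 * complex_of_real x) * complex_of_real (ln 2)) = complex_of_real (exp ((1 - 2 * x) * ln 2))"
      by (simp flip: exp_of_real)
    moreover have "Gamma (2 * complex_of_real x) = complex_of_real (Gamma (2 * x))"
      by (simp flip: Gamma_complex_of_real)
    ultimately show ?thesis by (simp add: powr_def)
  qed
  finally show ?thesis by (simp only: of_real_eq_iff)
qed

text \<open>With v = \<open>(1 - t) / 2\<close> one has \<open>sq_dist 1 t = 4 * v\<close> and
  \<open>1 - t\<^sup>2 = 4 * v * (1 - v)\<close>, which leaves a Beta integral; the leading 2 comes
  from dt = -2 dv.\<close>

lemma zonal_int_at_1:
  assumes "k \<ge> 0"
  shows "zonal_int d k 1 = 2 * 4 powr (k + d / 2) * Beta (k + d / 2 + 1) (d / 2 + 1)"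
  unfolding zonal_int_def
proof (rule integral_unique)
  let ?B = "Beta (k + d / 2 + 1) (d / 2 + 1)"
  have im: "(\<lambda>x. (1 / (-1/2)) *\<^sub>R x + - ((1 / (-1/2)) *\<^sub>R (1/2))) ` cbox 0 1 = {-1..1::real}"
  proof -
    have "x \<in> (\<lambda>x. 1 - 2 * x) ` {0..1}" if "x \<in> {-1..1}" for x :: real
      using that by (intro image_eqI[of _ _ "(1 - x) / 2"]) (auto simp: field_simps)
    then show ?thesis by auto
  qed
  have "((\<lambda>v. v powr (k + d / 2) * (1 - v) powr (d / 2)) has_integral ?B) (cbox 0 1)"
    using has_integral_Beta_real[of "k + d / 2 + 1" "d / 2 + 1"] assms by (simp add: add_nonneg_pos)
  from has_integral_affinity[OF this, of "-1/2" "1/2"]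
  have "((\<lambda>t. ((1 - t) / 2) powr (k + d / 2) * (1 - (1 - t) / 2) powr (d / 2)) has_integral 2 * ?B) {-1..1}"
    unfolding im by (simp add: diff_divide_distrib add.commute)
  from has_integral_mult_right[OF this, of "4 powr (k + d / 2)"]
  have "((\<lambda>t. 4 powr (k + d / 2) * (((1 - t) / 2) powr (k + d / 2) * (1 - (1 - t) / 2) powr (d / 2))) has_integral 2 * 4 powr (k + d / 2) * ?B) {-1..1}"
    by (simp add: mult_ac)
  then show "((\<lambda>t. sq_dist 1 t powr k * sqrt (1 - t\<^sup>2) ^ d) has_integral 2 * 4 powr (k + d / 2) * ?B) {-1..1}"
  \<comment> \<open>The endpoints are left out because \<open>0 ^ 0 = 1\<close> and
    \<open>0 powr 0 = 0\<close> can disagree there.\<close>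
  proof (rule has_integral_spike_finite[rotated 2])
    fix t :: real assume t: "t \<in> {-1..1} - {-1, 1}"
    define v where "v = (1 - t) / 2"
    have v: "v > 0" "v < 1" using t by (auto simp: v_def)
    have tv: "t = 1 - 2 * v" by (simp add: v_def field_simps)
    have D: "sq_dist 1 t = 4 * v" by (simp add: sq_dist_def tv)
    have "1 - t\<^sup>2 = 4 * v * (1 - v)" by (simp add: tv power2_eq_square algebra_simps)
    then have "sqrt (1 - t\<^sup>2) = (4 * v * (1 - v)) powr (1/2)" using v by (simp add: powr_half_sqrt)
    then have "sqrt (1 - t\<^sup>2) ^ d = (4 * v * (1 - v)) powr (d/2)"
      using v by (simp add: powr_powr flip: powr_realpow)
    also have "\<dots> = 4 powr (d/2) * v powr (d/2) * (1 - v) powr (d/2)" using v by (simp add: powr_mult)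
    finally show "sq_dist 1 t powr k * sqrt (1 - t\<^sup>2) ^ d = 4 powr (k + d / 2) * (((1 - t) / 2) powr (k + d / 2) * (1 - (1 - t) / 2) powr (d / 2))"
      unfolding v_def[symmetric] D using v by (simp add: powr_add powr_mult mult_ac)
  qed auto
qed

text \<open>The integrands can differ only at \<open>t = 1\<close>, where the distance is 0 and
  \<open>0 powr 0 = 0\<close>. This makes the normalising constant a Beta value too.\<close>

lemma zonal_int_0_at_1: "zonal_int d 0 1 = zonal_int d 0 0"
  unfolding zonal_int_def
  by (rule integral_spike[of "{1}"]) (auto simp: sq_dist_def)

lemma zonal_int_0_pos: "zonal_int d 0 0 > 0"
  unfolding zonal_int_0_at_1[symmetric] by (subst zonal_int_at_1) (auto simp: Beta_def intro!: divide_pos_pos mult_pos_pos Gamma_real_pos add_nonneg_pos add_pos_pos)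

text \<open>The hypothesis on \<open>s\<close> says \<open>k \<ge> 0\<close>, so both integrals are
  Beta values, with the same second argument \<open>y\<close>. Legendre duplication at
  \<open>x\<close> and at \<open>y\<close> brings in the half-shifted Gamma arguments, and the
  powers of 2 cancel \<open>4 powr k\<close>.\<close>

lemma zonal_int_ratio:
  assumes n: "n = real d + 3" and s: "s \<ge> 2 * (n - 1)"
  shows "zonal_int d (s / 2 - n + 1) 1 / zonal_int d 0 0 = Gamma (n/2) * Gamma (s - n + 1) / (Gamma (s/2) * Gamma ((s - n + 2)/2))"
proof -
  define k where "k = s / 2 - n + 1"
  define x y where "x = (s - n + 1) / 2" and "y = (n - 1) / 2"
  have k: "k \<ge> 0" using s by (simp add: k_def)
  have xy: "x > 0" "y > 0" using s n by (auto simp: x_def y_def)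
  have e: "k + d / 2 + 1 = x" "d / 2 + 1 = y" "x + y = s / 2" "y + y = 2 * y" "2 * x = s - n + 1" "x + 1/2 = (s - n + 2)/2" "y + 1/2 = n/2" 
    using n by (auto simp: k_def x_def y_def field_simps)
  have e0: "0 + d / 2 + 1 = y" using e by simp
  have G: "Gamma x > 0" "Gamma y > 0" "Gamma (x + 1/2) > 0" "Gamma (y + 1/2) > 0" "Gamma (2 * y) > 0" "Gamma (x + y) > 0"
    using xy by (auto intro!: Gamma_real_pos)
  have p: "4 powr (k + d / 2) = 4 powr k * 4 powr (0 + d / 2)" by (simp add: powr_add)
  have "zonal_int d k 1 / zonal_int d 0 0 = 4 powr k * (Gamma x * Gamma (2 * y)) / (Gamma (x + y) * Gamma y)"
    unfolding zonal_int_0_at_1[symmetric] zonal_int_at_1[OF k] zonal_int_at_1[OF order_refl] e e0 p Beta_def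
    using G by (simp add: field_simps)
  also have "Gamma x = 2 powr (1 - 2 * x) * sqrt pi * Gamma (2 * x) / Gamma (x + 1/2)"
    using Gamma_duplication_real[OF xy(1)] G by (simp add: field_simps)
  also have "Gamma y = 2 powr (1 - 2 * y) * sqrt pi * Gamma (2 * y) / Gamma (y + 1/2)"
    using Gamma_duplication_real[OF xy(2)] G by (simp add: field_simps)
  also have "2 powr (1 - 2 * x) = 2 powr (1 - 2 * y) * 4 powr (- k)"
  proof -
    have "4 powr (- k) = (2 powr 2) powr (- k)" by simp
    also have "\<dots> = 2 powr (- 2 * k)" by (simp only: powr_powr) simp
    finally have "2 powr (1 - 2 * y) * 4 powr (- k) = 2 powr ((1 - 2 * y) + (- 2 * k))"
      by (simp only: powr_add)
    also have "(1 - 2 * y) + (- 2 * k) = 1 - 2 * x"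
      by (simp add: k_def x_def y_def field_simps)
    finally show ?thesis ..
  qed
  finally show ?thesis using G unfolding k_def[symmetric] e
    by (simp add: powr_minus_divide field_simps)
qed

section \<open>Moments of the weight on the interval\<close>

definition weight_moment :: "nat \<Rightarrow> nat \<Rightarrow> real" where
  "weight_moment d n = integral {-1..1} (\<lambda>t. t ^ n * sqrt (1 - t\<^sup>2) ^ d)"

lemma weight_moment_0: "weight_moment d 0 = zonal_int d 0 0"
  by (simp add: weight_moment_def zonal_int_def sq_dist_def)

lemma weight_integrable:
  assumes "continuous_on {-1..1} f"
  shows "(\<lambda>t. f t * sqrt (1 - t\<^sup>2) ^ d) integrable_on {-1..1::real}"
  by (intro integrable_continuous_real continuous_intros assms)

lemma weight_moment_odd:
  assumes "odd n" shows "weight_moment d n = 0"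
proof -
  have "weight_moment d n = integral {- 1..- (- 1)} (\<lambda>t. (- t) ^ n * sqrt (1 - (- t)\<^sup>2) ^ d)"
    unfolding weight_moment_def by (subst Henstock_Kurzweil_Integration.integral_reflect_real) simp
  also have "\<dots> = - weight_moment d n"
    using assms by (simp add: weight_moment_def)
  finally show ?thesis by simp
qed

text \<open>Integrate the derivative of \<open>F\<close>, which vanishes at both endpoints;
  \<open>s ^ (d + 2) = (1 - t\<^sup>2) * s ^ d\<close> sorts it into the two moments.\<close>

lemma weight_moment_Suc_Suc:
  "(2 * real k + real d + 3) * weight_moment d (2 * k + 2) = (2 * real k + 1) * weight_moment d (2 * k)"
proof -
  define F where "F t = t ^ (2 * k + 1) * sqrt (1 - t\<^sup>2) ^ (d + 2)" for t :: real
  define G where "G t = (2 * real k + 1) * (t ^ (2 * k) * sqrt (1 - t\<^sup>2) ^ d) - (2 * real k + real d + 3) * (t ^ (2 * k + 2) * sqrt (1 - t\<^sup>2) ^ d)" for t :: real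
  have G1: "(G has_integral (F 1 - F (- 1))) {-1..1}"
  \<comment> \<open>\<open>sqrt\<close> is not differentiable at 0, so the derivative is taken in
    the open interval only.\<close>
  proof (rule fundamental_theorem_of_calculus_interior)
    show "continuous_on {-1..1} F" unfolding F_def by (intro continuous_intros)
    fix t :: real assume "t \<in> {-1<..<1}"
    then have t: "1 - t\<^sup>2 > 0" by (simp add: abs_square_less_1 abs_less_iff)
    define s where "s = sqrt (1 - t\<^sup>2)"
    have s: "s > 0" "s\<^sup>2 = 1 - t\<^sup>2" using t by (auto simp: s_def)
    have ds: "((\<lambda>t. sqrt (1 - t\<^sup>2)) has_real_derivative (- t / s)) (at t)"
      using t by (auto intro!: derivative_eq_intros simp: s_def field_simps)
    have "(F has_real_derivative (real (2 * k + 1) * t ^ (2 * k) * s ^ (d + 2) + real (d + 2) * s ^ (d + 1) * (- t / s) * t ^ (2 * k + 1))) (at t)"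
      unfolding F_def by (rule derivative_eq_intros ds refl)+ (simp add: s_def)
    moreover have "real (2 * k + 1) * t ^ (2 * k) * s ^ (d + 2) + real (d + 2) * s ^ (d + 1) * (- t / s) * t ^ (2 * k + 1) = G t"
    proof -
      have *: "s ^ (d + 2) = (1 - t\<^sup>2) * s ^ d"
        unfolding s(2)[symmetric] by (simp add: power_add power2_eq_square mult_ac)
      have **: "s ^ (d + 1) * (- t / s) = - t * s ^ d"
        using s by simp
      have "real (2 * k + 1) * t ^ (2 * k) * s ^ (d + 2) + real (d + 2) * s ^ (d + 1) * (- t / s) * t ^ (2 * k + 1)
        = real (2 * k + 1) * t ^ (2 * k) * s ^ (d + 2) + real (d + 2) * (s ^ (d + 1) * (- t / s)) * t ^ (2 * k + 1)"
        by (simp only: mult.assoc)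
      also have "\<dots> = G t"
        unfolding * ** G_def s_def[symmetric] by (simp add: power2_eq_square algebra_simps)
      finally show ?thesis .
    qed
    ultimately show "(F has_vector_derivative G t) (at t)"
      by (simp add: has_real_derivative_iff_has_vector_derivative)
  qed simp
  have "F 1 - F (- 1) = 0" by (simp add: F_def)
  moreover have G2: "(G has_integral ((2 * real k + 1) * weight_moment d (2 * k) - (2 * real k + real d + 3) * weight_moment d (2 * k + 2))) {-1..1}"
    unfolding G_def weight_moment_def
    by (intro has_integral_diff has_integral_mult_right integrable_integral weight_integrable continuous_intros)
  note has_integral_unique[OF G1 G2]
  ultimately show ?thesis by linarith
qed

section \<open>Surface measure and zonal functions\<close>

text \<open>Setting \<open>x = 0\<close> isolates the first coefficient, and differentiating
  termwise shifts the others down, multiplied by positive integers. It serves to compare two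
  expansions of a Gaussian integral.\<close>

lemma powser_zero_imp_coeff_zero:
  fixes c :: "nat \<Rightarrow> real"
  assumes "\<And>x. (\<lambda>n. c n * x ^ n) sums 0"
  shows "c n = 0"
  using assms
proof (induction n arbitrary: c)
  case 0
  from 0[of 0] show ?case by simp
next
  case (Suc n)
  have s: "summable (\<lambda>n. c n * x ^ n)" for x using Suc.prems sums_summable by blast
  have z: "(\<lambda>x. \<Sum>n. c n * x ^ n) = (\<lambda>_. 0)" using Suc.prems sums_unique by metis
  have "(\<lambda>n. diffs c n * x ^ n) sums 0" for x
  proof -
    have "DERIV (\<lambda>x. \<Sum>n. c n * x ^ n) x :> (\<Sum>n. diffs c n * x ^ n)"
      by (rule termdiffs_strong[of c "norm x + 1", OF s]) simp
    then have "(\<Sum>n. diffs c n * x ^ n) = 0" unfolding z using DERIV_const DERIV_unique by blast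
    moreover have "summable (\<lambda>n. diffs c n * x ^ n)"
      by (rule termdiff_converges[of x "norm x + 1"]) (use s in auto)
    ultimately show ?thesis using summable_sums by metis
  qed
  then have "diffs c n = 0" by (rule Suc.IH)
  then show ?case by (simp add: diffs_def)
qed

text \<open>At \<open>0\<close>, where \<open>sgn\<close> would leave the sphere, the value is an arbitrary unit vector.\<close>
definition sphere_dir :: "'a::euclidean_space \<Rightarrow> 'a" where
  "sphere_dir y = (if y = 0 then (SOME b. b \<in> Basis) else sgn y)"

lemma norm_sphere_dir [simp]: "norm (sphere_dir y) = 1"
  by (auto simp: sphere_dir_def norm_sgn SOME_Basis)

lemma measurable_sphere_dir [measurable]: "sphere_dir \<in> borel \<rightarrow>\<^sub>M borel"
  unfolding sphere_dir_def[abs_def] sgn_div_norm by measurable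

lemma measurable_sphere_dir' [measurable]: "sphere_dir \<in> borel \<rightarrow>\<^sub>M restrict_space borel (sphere 0 1)"
  by (rule measurable_restrict_space2) auto

section \<open>Surface measure as an image of Lebesgue measure\<close>

lemma emeasure_lborel_punctured_cball:
  "emeasure lborel (cball (0::'a::euclidean_space) 1 - {0}) = emeasure lborel (ball (0::'a) 1)"
proof -
  have "emeasure lborel (cball (0::'a) 1 - {0}) = emeasure lborel (cball (0::'a) 1)"
    by (rule emeasure_Diff_null_set) auto
  then show ?thesis by (simp add: emeasure_cball emeasure_ball)
qed

text \<open>The cone over \<open>A\<close> is the part of the punctured ball that
  \<open>sphere_dir\<close> maps into \<open>A\<close>. Hence the set function in the definition is
  a genuine measure; otherwise \<open>measure_of\<close> would collapse to the null measure.\<close>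

lemma sphere_measure_eq_distr:
  "sphere_measure N = distr (uniform_measure lborel (cball (0::real^'n) 1 - {0})) (restrict_space borel (sphere 0 1)) sphere_dir"
  for N :: "'n::finite itself"
proof -
  let ?S = "restrict_space borel (sphere (0::real^'n) 1)"
  let ?M = "uniform_measure lborel (cball (0::real^'n) 1 - {0})"
  have sp: "space ?S = sphere 0 1" by (simp add: space_restrict_space)
  have "measure_of (sphere 0 1) (sets ?S)
     (\<lambda>A. emeasure lborel {t *\<^sub>R x | t x. 0 < t \<and> t \<le> 1 \<and> x \<in> A}
          / emeasure lborel (ball (0::real^'n) 1)) = measure_of (sphere 0 1) (sets ?S)
     (\<lambda>A. emeasure ?M (sphere_dir -` A \<inter> space ?M))"
  proof (rule measure_of_eq)
    show "sets ?S \<subseteq> Pow (sphere 0 1)" using sets.space_closed[of ?S] unfolding sp .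
    fix A assume "A \<in> sigma_sets (sphere 0 1) (sets ?S)"
    then have A: "A \<in> sets ?S" using sets.sigma_sets_eq[of ?S] unfolding sp by blast
    then have A1: "A \<subseteq> sphere 0 1" using sets.sets_into_space[OF A] sp by blast
    have eq: "{t *\<^sub>R x | t x. 0 < t \<and> t \<le> 1 \<and> x \<in> A} = (cball 0 1 - {0}) \<inter> sphere_dir -` A"
    proof (intro equalityI subsetI)
      fix y assume "y \<in> {t *\<^sub>R x | t x. 0 < t \<and> t \<le> 1 \<and> x \<in> A}"
      then obtain t x where *: "y = t *\<^sub>R x" "0 < t" "t \<le> 1" "x \<in> A" by blast
      moreover from * A1 have "norm x = 1" by auto
      ultimately show "y \<in> (cball 0 1 - {0}) \<inter> sphere_dir -` A"
        by (auto simp: sphere_dir_def sgn_div_norm)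
    next
      fix y assume y: "y \<in> (cball 0 1 - {0}) \<inter> sphere_dir -` A"
      then have "y = norm y *\<^sub>R sphere_dir y" by (auto simp: sphere_dir_def sgn_div_norm)
      with y show "y \<in> {t *\<^sub>R x | t x. 0 < t \<and> t \<le> 1 \<and> x \<in> A}"
        by (intro CollectI exI[of _ "norm y"] exI[of _ "sphere_dir y"]) auto
    qed
    have "sphere_dir -` A \<in> sets (borel :: (real^'n) measure)"
      using measurable_sets[OF measurable_sphere_dir' A] by simp
    then show "emeasure lborel {t *\<^sub>R x | t x. 0 < t \<and> t \<le> 1 \<and> x \<in> A} / emeasure lborel (ball (0::real^'n) 1)
      = emeasure ?M (sphere_dir -` A \<inter> space ?M)"
      unfolding eq by (simp add: emeasure_lborel_punctured_cball)
  qed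
  then show ?thesis unfolding sphere_measure_def distr_def sp .
qed

lemma sets_sphere_measure [measurable_cong]: "sets (sphere_measure (N::'n::finite itself)) = sets (restrict_space borel (sphere (0::real^'n) 1))"
  by (simp add: sphere_measure_eq_distr)

lemma space_sphere_measure: "space (sphere_measure (N::'n::finite itself)) = sphere (0::real^'n) 1"
  by (simp add: sphere_measure_eq_distr space_restrict_space)

lemma emeasure_ball_pos_finite:
  "emeasure lborel (ball (0::'a::euclidean_space) 1) \<noteq> 0" "emeasure lborel (ball (0::'a) 1) \<noteq> \<infinity>"
  using unit_ball_vol_pos[of "real DIM('a)"] by (simp_all add: emeasure_ball del: unit_ball_vol_pos)

lemma prob_space_sphere_measure: "prob_space (sphere_measure (N::'n::finite itself))"
  unfolding sphere_measure_eq_distr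
  by (intro prob_space.prob_space_distr prob_space_uniform_measure)
     (auto simp: emeasure_lborel_punctured_cball emeasure_ball_pos_finite[simplified]) 

text \<open>The volume stands as a factor on the left to avoid division in \<open>ennreal\<close>;
  the origin returns to the ball as a null set.\<close>

lemma nn_integral_sphere_measure:
  fixes N :: "'n::finite itself" and h :: "real^'n \<Rightarrow> ennreal"
  assumes [measurable]: "h \<in> borel_measurable borel"
  shows "(\<integral>\<^sup>+\<eta>. h \<eta> \<partial>sphere_measure N) * emeasure lborel (ball (0::real^'n) 1)
     = (\<integral>\<^sup>+y. h (sphere_dir y) * indicator (cball 0 1) y \<partial>lborel)"
proof -
  have "(\<integral>\<^sup>+\<eta>. h \<eta> \<partial>sphere_measure N) = (\<integral>\<^sup>+y. h (sphere_dir y) \<partial>uniform_measure lborel (cball (0::real^'n) 1 - {0}))"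
    unfolding sphere_measure_eq_distr
    by (rule nn_integral_distr) (auto intro: measurable_restrict_space1)
  also have "\<dots> = (\<integral>\<^sup>+y. h (sphere_dir y) * indicator (cball 0 1 - {0}) y \<partial>lborel) / emeasure lborel (ball (0::real^'n) 1)"
    by (subst nn_integral_uniform_measure) (auto simp: emeasure_lborel_punctured_cball)
  also have "(\<integral>\<^sup>+y. h (sphere_dir y) * indicator (cball 0 1 - {0}) y \<partial>lborel) = (\<integral>\<^sup>+y. h (sphere_dir y) * indicator (cball 0 1) y \<partial>lborel)"
    using AE_lborel_singleton[of "0::real^'n"] by (intro nn_integral_cong_AE) (auto elim!: eventually_mono split: split_indicator)
  finally show ?thesis using emeasure_ball_pos_finite[where 'a="real^'n"]
    by (simp add: ennreal_divide_times ennreal_mult_divide_eq mult_divide_eq_ennreal divide_mult_eq less_top)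
qed

section \<open>Polar coordinates\<close>

lemma sphere_dir_scaleR: "c > 0 \<Longrightarrow> sphere_dir (c *\<^sub>R y) = sphere_dir y"
  by (simp add: sphere_dir_def sgn_scaleR)

lemma nn_integral_lborel_scaleR:
  fixes f :: "'a::euclidean_space \<Rightarrow> ennreal"
  assumes [measurable]: "f \<in> borel_measurable borel" and "R \<noteq> 0"
  shows "(\<integral>\<^sup>+y. f y \<partial>lborel) = (\<integral>\<^sup>+x. ennreal (\<bar>R\<bar> ^ DIM('a)) * f (R *\<^sub>R x) \<partial>lborel)"
proof -
  have "(\<integral>\<^sup>+y. f y \<partial>lborel) = (\<integral>\<^sup>+y. f y \<partial>density (distr lborel borel (\<lambda>x::'a. R *\<^sub>R x)) (\<lambda>_. ennreal (\<bar>R\<bar> ^ DIM('a))))"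
    using lborel_affine[of R "0::'a"] assms(2) by simp
  also have "\<dots> = (\<integral>\<^sup>+y. ennreal (\<bar>R\<bar> ^ DIM('a)) * f y \<partial>distr lborel borel (\<lambda>x::'a. R *\<^sub>R x))"
    by (rule nn_integral_density) auto
  also have "\<dots> = (\<integral>\<^sup>+x. ennreal (\<bar>R\<bar> ^ DIM('a)) * f (R *\<^sub>R x) \<partial>lborel)"
    by (rule nn_integral_distr) auto
  finally show ?thesis .
qed

text \<open>\<open>h (sphere_dir y)\<close> depends on the direction only, so rescaling to radius 1
  costs just the Jacobian.\<close>

lemma nn_integral_scaled_cball:
  fixes N :: "'n::finite itself" and h :: "real^'n \<Rightarrow> ennreal"
  assumes [measurable]: "h \<in> borel_measurable borel" and "R \<ge> 0"
  shows "(\<integral>\<^sup>+y. h (sphere_dir y) * indicator (cball 0 R) y \<partial>lborel) = 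
     ennreal (R ^ CARD('n)) * (emeasure lborel (ball (0::real^'n) 1) * (\<integral>\<^sup>+\<eta>. h \<eta> \<partial>sphere_measure N))"
proof (cases "R = 0")
  case True
  have "(\<integral>\<^sup>+y. h (sphere_dir y) * indicator (cball 0 R) y \<partial>lborel) = (\<integral>\<^sup>+y. 0 \<partial>(lborel :: (real^'n) measure))"
    by (rule nn_integral_cong_AE, rule AE_mp[OF AE_lborel_singleton[of "0::real^'n"]]) (use True in auto)
  then show ?thesis using True by simp
next
  case False
  with assms have R: "R > 0" by simp
  have [simp]: "indicator (cball 0 R) (R *\<^sub>R x) = (indicator (cball 0 1) x :: ennreal)" for x :: "real^'n"
    using R by (simp add: indicator_def)
  have [measurable]: "cball (0::real^'n) R \<in> sets borel" "cball (0::real^'n) 1 \<in> sets borel" by simp_all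
  have "(\<lambda>y. h (sphere_dir y) * indicator (cball 0 R) y) \<in> borel_measurable borel"
    by measurable
  then have "(\<integral>\<^sup>+y. h (sphere_dir y) * indicator (cball 0 R) y \<partial>lborel) = 
    (\<integral>\<^sup>+x. ennreal (R ^ CARD('n)) * (h (sphere_dir x) * indicator (cball 0 1) x) \<partial>lborel)"
    using R by (subst nn_integral_lborel_scaleR[of _ R]) (simp_all add: sphere_dir_scaleR)
  also have "\<dots> = ennreal (R ^ CARD('n)) * (\<integral>\<^sup>+x. h (sphere_dir x) * indicator (cball 0 1) x \<partial>lborel)"
    by (rule nn_integral_cmult) measurable
  finally show ?thesis
    unfolding nn_integral_sphere_measure[OF assms(1), of N, symmetric] by (simp only: mult.commute)
qed

text \<open>Both sides integrate \<open>F\<close> against a measure on the line: \<open>A\<close> is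
  the image under the norm of Lebesgue measure with density \<open>h (sphere_dir y)\<close>, and
  \<open>B\<close> has a multiple of \<open>r ^ (CARD('n) - 1)\<close> as density. They agree on the
  half-lines \<open>{..R}\<close> by \<open>nn_integral_scaled_cball\<close>; \<open>fin\<close>
  makes these values finite, as uniqueness of measures requires.\<close>

lemma nn_integral_polar:
  fixes N :: "'n::finite itself" and h :: "real^'n \<Rightarrow> ennreal" and F :: "real \<Rightarrow> ennreal"
  assumes [measurable]: "h \<in> borel_measurable borel" "F \<in> borel_measurable borel"
    and fin: "(\<integral>\<^sup>+\<eta>. h \<eta> \<partial>sphere_measure N) < \<infinity>"
  shows "(\<integral>\<^sup>+y. F (norm y) * h (sphere_dir y) \<partial>lborel) =
     (\<integral>\<^sup>+r. F r * (ennreal (CARD('n) * r ^ (CARD('n) - 1)) * indicator {0..} r) \<partial>lborel) *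
     (emeasure lborel (ball (0::real^'n) 1) * (\<integral>\<^sup>+\<eta>. h \<eta> \<partial>sphere_measure N))"
proof -
  define K where "K = emeasure lborel (ball (0::real^'n) 1) * (\<integral>\<^sup>+\<eta>. h \<eta> \<partial>sphere_measure N)"
  have K: "K < \<infinity>" unfolding K_def using fin emeasure_ball_pos_finite[where 'a="real^'n"]
    by (simp add: ennreal_mult_less_top less_top)
  define A where "A = distr (density lborel (\<lambda>y. h (sphere_dir y))) borel (norm :: real^'n \<Rightarrow> real)"
  define B where "B = density lborel (\<lambda>r. K * (ennreal (CARD('n) * r ^ (CARD('n) - 1)) * indicator {0..} r))"
  have Aeq: "emeasure A {..R} = (if R < 0 then 0 else ennreal (R ^ CARD('n)) * K)" for R
  proof -
    have "emeasure A {..R} = (\<integral>\<^sup>+y. h (sphere_dir y) * indicator (cball 0 R) y \<partial>lborel)"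
    proof -
      have [measurable]: "norm -` {..R} \<in> sets (borel :: (real^'n) measure)"
        by (intro borel_closed closed_vimage) (auto intro: continuous_intros)
      show ?thesis unfolding A_def
        by (simp add: emeasure_distr emeasure_density) (auto intro!: nn_integral_cong split: split_indicator)
    qed
    moreover have "R < 0 \<Longrightarrow> cball (0::real^'n) R = {}" by simp
    ultimately show ?thesis by (auto simp: nn_integral_scaled_cball[of h R N] K_def)
  qed
  have Beq: "emeasure B {..R} = (if R < 0 then 0 else ennreal (R ^ CARD('n)) * K)" for R
  proof -
    have "emeasure B {..R} = (\<integral>\<^sup>+r. K * (ennreal (CARD('n) * r ^ (CARD('n) - 1)) * indicator {0..R} r) \<partial>lborel)"
      unfolding B_def by (subst emeasure_density) (auto intro!: nn_integral_cong split: split_indicator)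
    also have "\<dots> = K * (\<integral>\<^sup>+r. ennreal (CARD('n) * r ^ (CARD('n) - 1)) * indicator {0..R} r \<partial>lborel)"
      by (rule nn_integral_cmult) measurable
    also have "\<dots> = (if R < 0 then 0 else ennreal (R ^ CARD('n)) * K)"
    proof (cases "R < 0")
      case False
      have "(\<integral>\<^sup>+r. ennreal (CARD('n) * r ^ (CARD('n) - 1)) * indicator {0..R} r \<partial>lborel) = ennreal (R ^ CARD('n) - 0 ^ CARD('n))"
        using False by (intro nn_integral_FTC_Icc) (auto intro!: derivative_eq_intros)
      moreover have "(0::real) ^ CARD('n) = 0" by simp
      ultimately show ?thesis using False by (simp add: mult.commute del: power_eq_0_iff)
    qed simp
    finally show ?thesis .
  qed
  have "A = B"
  proof (rule measure_eqI_generator_eq[where E="range atMost" and A="\<lambda>i. {..real i}" and \<Omega>=UNIV])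
    show "Int_stable (range (atMost :: real \<Rightarrow> real set))"
      by (auto simp: Int_stable_def)
    show "sets A = sigma_sets UNIV (range atMost)" "sets B = sigma_sets UNIV (range atMost)"
      unfolding A_def B_def by (simp_all add: borel_eq_atMost)
    show "(\<Union>i. {..real i}) = UNIV" using real_arch_simple by auto
    show "emeasure A {..real i} \<noteq> \<infinity>" for i unfolding Aeq using K by (simp add: ennreal_mult_eq_top_iff)
  qed (auto simp: Aeq Beq)
  have "(\<integral>\<^sup>+y. F (norm y) * h (sphere_dir y) \<partial>lborel) = (\<integral>\<^sup>+r. F r \<partial>A)"
    unfolding A_def by (simp add: nn_integral_distr nn_integral_density mult.commute)
  also have "\<dots> = (\<integral>\<^sup>+r. K * (F r * (ennreal (CARD('n) * r ^ (CARD('n) - 1)) * indicator {0..} r)) \<partial>lborel)"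
    unfolding \<open>A = B\<close> B_def by (subst nn_integral_density) (auto simp: ac_simps)
  also have "\<dots> = K * (\<integral>\<^sup>+r. F r * (ennreal (CARD('n) * r ^ (CARD('n) - 1)) * indicator {0..} r) \<partial>lborel)"
    by (rule nn_integral_cmult) measurable
  finally show ?thesis unfolding K_def by (simp add: mult.commute)
qed

section \<open>Gaussian moments\<close>

fun half_gauss :: "nat \<Rightarrow> real" where
  "half_gauss 0 = sqrt pi / 2"
| "half_gauss (Suc 0) = 1 / 2"
| "half_gauss (Suc (Suc m)) = real (Suc m) / 2 * half_gauss m"

lemma half_gauss_pos: "half_gauss m > 0"
  by (induction m rule: half_gauss.induct) auto

text \<open>\<open>half_gauss m\<close> is \<open>Gamma ((m + 1) / 2) / 2\<close>; its recursion is
  matched with the factorial formulas for even and odd Gaussian moments.\<close>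

lemma has_bochner_integral_half_gauss:
  "has_bochner_integral lborel (\<lambda>x::real. indicator {0..} x *\<^sub>R (exp (- x\<^sup>2) * x ^ m)) (half_gauss m)"
proof (cases "even m")
  case True
  then obtain k where m: "m = 2 * k" by blast
  have "half_gauss (2 * k) * (2 ^ (2 * k) * fact k) = (sqrt pi / 2) * fact (2 * k)"
  proof (induction k)
    case (Suc k)
    have "half_gauss (2 * Suc k) * (2 ^ (2 * Suc k) * fact (Suc k))
      = (2 * real k + 1) * (2 * real k + 2) * (half_gauss (2 * k) * (2 ^ (2 * k) * fact k))"
      by (simp add: field_simps)
    also have "\<dots> = (sqrt pi / 2) * fact (2 * Suc k)"
      unfolding Suc.IH by (simp add: algebra_simps)
    finally show ?case .
  qed simp
  then have "half_gauss (2 * k) = (sqrt pi / 2) * (fact (2 * k) / (2 ^ (2 * k) * fact k))"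
    by (simp add: field_simps)
  then show ?thesis using gaussian_moment_even_pos[of k] by (simp add: m)
next
  case False
  then obtain k where m: "m = 2 * k + 1" by (auto elim: oddE)
  have "half_gauss (2 * k + 1) = fact k / 2"
    by (induction k) (auto simp: field_simps)
  then show ?thesis using gaussian_moment_odd_pos[of k] unfolding m by (simp only:)
qed

lemma nn_integral_half_gauss:
  "(\<integral>\<^sup>+r. ennreal (exp (- r\<^sup>2) * r ^ m) * indicator {0..} r \<partial>lborel) = ennreal (half_gauss m)"
proof -
  have "(\<integral>\<^sup>+r. ennreal (exp (- r\<^sup>2) * r ^ m) * indicator {0..} r \<partial>lborel)
     = (\<integral>\<^sup>+r. ennreal (indicator {0..} r *\<^sub>R (exp (- r\<^sup>2) * r ^ m)) \<partial>lborel)"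
    by (intro nn_integral_cong) (auto split: split_indicator)
  also have "\<dots> = ennreal (half_gauss m)"
    using has_bochner_integral_half_gauss[of m] unfolding has_bochner_integral_iff
    by (subst nn_integral_eq_integral) (auto split: split_indicator)
  finally show ?thesis .
qed

text \<open>Translation by \<open>(c / 2) *\<^sub>R v\<close> completes the square.\<close>

lemma nn_integral_gauss_exp:
  fixes v :: "'a::euclidean_space"
  assumes "norm v = 1"
  shows "(\<integral>\<^sup>+y. ennreal (exp (- (norm y)\<^sup>2) * exp (c * (y \<bullet> v))) \<partial>lborel) = ennreal (exp (c\<^sup>2 / 4)) * (\<integral>\<^sup>+y. ennreal (exp (- (norm (y::'a))\<^sup>2)) \<partial>lborel)"
proof -
  let ?g = "\<lambda>y::'a. ennreal (exp (- (norm y)\<^sup>2) * exp (c * (y \<bullet> v)))"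
  have "(\<integral>\<^sup>+y. ?g y \<partial>lborel) = (\<integral>\<^sup>+y. ?g y \<partial>distr lborel borel ((+) ((c / 2) *\<^sub>R v)))"
    unfolding lborel_distr_plus ..
  also have "\<dots> = (\<integral>\<^sup>+y. ?g ((c / 2) *\<^sub>R v + y) \<partial>lborel)"
    by (rule nn_integral_distr) auto
  also have "\<dots> = (\<integral>\<^sup>+y. ennreal (exp (c\<^sup>2 / 4)) * ennreal (exp (- (norm (y::'a))\<^sup>2)) \<partial>lborel)"
  proof (rule nn_integral_cong)
    fix y :: 'a
    have vv: "v \<bullet> v = 1" using assms by (simp add: norm_eq_1)
    have "- (norm ((c / 2) *\<^sub>R v + y))\<^sup>2 + c * (((c / 2) *\<^sub>R v + y) \<bullet> v) = c\<^sup>2 / 4 + - (norm y)\<^sup>2"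
      unfolding power2_norm_eq_inner
      by (simp add: algebra_simps vv inner_commute power2_eq_square)
    then show "?g ((c / 2) *\<^sub>R v + y) = ennreal (exp (c\<^sup>2 / 4)) * ennreal (exp (- (norm y)\<^sup>2))"
      by (simp only: exp_add[symmetric] ennreal_mult[symmetric] exp_ge_zero)
  qed
  also have "\<dots> = ennreal (exp (c\<^sup>2 / 4)) * (\<integral>\<^sup>+y. ennreal (exp (- (norm (y::'a))\<^sup>2)) \<partial>lborel)"
    by (rule nn_integral_cmult) auto
  finally show ?thesis .
qed

text \<open>Comparing the coefficients of \<open>c\<close> below gives the Gaussian moments of \<open>y \<bullet> v\<close> for every unit
  vector \<open>v\<close> from translation invariance alone, so rotation invariance of \<open>lborel\<close> is not needed.\<close>
lemma nn_integral_gauss_cosh: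
  fixes v :: "'a::euclidean_space"
  assumes "norm v = 1"
  shows "(\<integral>\<^sup>+y. ennreal (exp (- (norm y)\<^sup>2) * cosh (c * (y \<bullet> v))) \<partial>lborel) = ennreal (exp (c\<^sup>2 / 4)) * (\<integral>\<^sup>+y. ennreal (exp (- (norm (y::'a))\<^sup>2)) \<partial>lborel)"
proof -
  let ?Z = "ennreal (exp (c\<^sup>2 / 4)) * (\<integral>\<^sup>+y. ennreal (exp (- (norm (y::'a))\<^sup>2)) \<partial>lborel)"
  have "ennreal (exp (- (norm y)\<^sup>2) * cosh (c * (y \<bullet> v))) = 
     ennreal (1/2) * (ennreal (exp (- (norm y)\<^sup>2) * exp (c * (y \<bullet> v))) + ennreal (exp (- (norm y)\<^sup>2) * exp ((- c) * (y \<bullet> v))))" for y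
  proof -
    have "ennreal (1/2) * (ennreal (exp (- (norm y)\<^sup>2) * exp (c * (y \<bullet> v))) + ennreal (exp (- (norm y)\<^sup>2) * exp ((- c) * (y \<bullet> v))))
       = ennreal (1/2 * (exp (- (norm y)\<^sup>2) * exp (c * (y \<bullet> v)) + exp (- (norm y)\<^sup>2) * exp ((- c) * (y \<bullet> v))))"
      by (simp only: ennreal_plus[symmetric] ennreal_mult[symmetric] mult_nonneg_nonneg exp_ge_zero add_nonneg_nonneg zero_le_divide_1_iff zero_le_numeral)
    also have "1/2 * (exp (- (norm y)\<^sup>2) * exp (c * (y \<bullet> v)) + exp (- (norm y)\<^sup>2) * exp ((- c) * (y \<bullet> v)))
       = exp (- (norm y)\<^sup>2) * cosh (c * (y \<bullet> v))"
      by (simp add: cosh_def field_simps)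
    finally show ?thesis ..
  qed
  then have "(\<integral>\<^sup>+y. ennreal (exp (- (norm y)\<^sup>2) * cosh (c * (y \<bullet> v))) \<partial>lborel) = 
     ennreal (1/2) * (\<integral>\<^sup>+y. ennreal (exp (- (norm y)\<^sup>2) * exp (c * (y \<bullet> v))) + ennreal (exp (- (norm y)\<^sup>2) * exp ((- c) * (y \<bullet> v))) \<partial>lborel)"
    by (simp add: nn_integral_cmult)
  also have "\<dots> = ennreal (1/2) * (?Z + ?Z)"
    by (subst nn_integral_add) (use nn_integral_gauss_exp[OF assms, of c] nn_integral_gauss_exp[OF assms, of "-c"] in auto)
  also have "\<dots> = (ennreal (1/2) + ennreal (1/2)) * ?Z"
    by (simp only: distrib_left distrib_right)
  also have "ennreal (1/2) + ennreal (1/2) = 1"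
    by (subst ennreal_plus[symmetric]) auto
  finally show ?thesis by simp
qed

lemma sphere_integrable_continuous:
  fixes f :: "real^'n::finite \<Rightarrow> 'b::{banach, second_countable_topology}"
  assumes f: "continuous_on (sphere 0 1) f"
  shows "integrable (sphere_measure (N :: 'n itself)) f"
proof -
  interpret prob_space "sphere_measure N" by (rule prob_space_sphere_measure)
  have "bounded (f ` sphere 0 1)" by (intro compact_imp_bounded compact_continuous_image f) auto
  then obtain B where B: "\<And>\<eta>. \<eta> \<in> sphere 0 1 \<Longrightarrow> norm (f \<eta>) \<le> B"
    unfolding bounded_iff by blast
  show ?thesis
  proof (rule integrable_const_bound[of _ B])
    show "f \<in> borel_measurable (sphere_measure N)"
      using borel_measurable_continuous_on_restrict[OF f]
      by (simp add: measurable_cong_sets[OF sets_sphere_measure refl])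
  qed (auto simp: space_sphere_measure intro!: AE_I2 B)
qed

lemma abs_inner_sphere_le_1: "norm v = 1 \<Longrightarrow> norm \<eta> = 1 \<Longrightarrow> \<bar>\<eta> \<bullet> v\<bar> \<le> 1"
  using Cauchy_Schwarz_ineq2[of \<eta> v] by simp

text \<open>The monomial is homogeneous, hence \<open>norm y ^ n\<close> times its value at the
  direction of \<open>y\<close>; the Jacobian adds \<open>CARD('n) - 1\<close> to the index of
  \<open>half_gauss\<close>. Evenness keeps the integrand nonnegative.\<close>

lemma nn_integral_gauss_moment:
  fixes v :: "real^'n::finite" and N :: "'n itself"
  assumes v: "norm v = 1" and n: "even n"
  shows "(\<integral>\<^sup>+y. ennreal (exp (- (norm y)\<^sup>2) * (y \<bullet> v) ^ n) \<partial>lborel) =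
     ennreal (CARD('n) * half_gauss (n + (CARD('n) - 1)) * measure lborel (ball (0::real^'n) 1) * (\<integral>\<eta>. (\<eta> \<bullet> v) ^ n \<partial>sphere_measure N))"
proof -
  have int: "integrable (sphere_measure N) (\<lambda>\<eta>. (\<eta> \<bullet> v) ^ n)"
    by (intro sphere_integrable_continuous continuous_intros)
  have m: "(\<integral>\<^sup>+\<eta>. ennreal ((\<eta> \<bullet> v) ^ n) \<partial>sphere_measure N) = ennreal (\<integral>\<eta>. (\<eta> \<bullet> v) ^ n \<partial>sphere_measure N)"
    using int n by (intro nn_integral_eq_integral) (auto simp: zero_le_even_power)
  define e where "e = CARD('n) - 1"
  have yv: "(y \<bullet> v) ^ n = norm y ^ n * (sphere_dir y \<bullet> v) ^ n" for y :: "real^'n"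
  proof -
    have "y = norm y *\<^sub>R sphere_dir y" by (auto simp: sphere_dir_def sgn_div_norm)
    then show ?thesis by (metis inner_scaleR_left power_mult_distrib)
  qed
  have "ennreal (exp (- (norm y)\<^sup>2) * (y \<bullet> v) ^ n) =
     ennreal (exp (- (norm y)\<^sup>2) * norm y ^ n) * ennreal ((sphere_dir y \<bullet> v) ^ n)" for y :: "real^'n"
    unfolding yv[of y] by (subst ennreal_mult[symmetric]) (use n in \<open>auto simp: zero_le_even_power mult.assoc\<close>)
  then have "(\<integral>\<^sup>+y. ennreal (exp (- (norm y)\<^sup>2) * (y \<bullet> v) ^ n) \<partial>lborel) = 
     (\<integral>\<^sup>+y. ennreal (exp (- (norm y)\<^sup>2) * norm y ^ n) * ennreal ((sphere_dir y \<bullet> v) ^ n) \<partial>lborel)"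
    by (simp only:)
  also have "\<dots> = (\<integral>\<^sup>+r. ennreal (exp (- r\<^sup>2) * r ^ n) * (ennreal (CARD('n) * r ^ e) * indicator {0..} r) \<partial>lborel) *
     (emeasure lborel (ball (0::real^'n) 1) * (\<integral>\<^sup>+\<eta>. ennreal ((\<eta> \<bullet> v) ^ n) \<partial>sphere_measure N))"
    unfolding e_def by (rule nn_integral_polar) (auto simp: m)
  also have "(\<integral>\<^sup>+r. ennreal (exp (- r\<^sup>2) * r ^ n) * (ennreal (CARD('n) * r ^ e) * indicator {0..} r) \<partial>lborel)
     = (\<integral>\<^sup>+r. ennreal (CARD('n)) * (ennreal (exp (- r\<^sup>2) * r ^ (n + e)) * indicator {0..} r) \<partial>lborel)"
    by (intro nn_integral_cong) (auto simp: power_add algebra_simps simp flip: ennreal_mult split: split_indicator)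
  also have "\<dots> = ennreal (CARD('n) * half_gauss (n + e))"
    by (subst nn_integral_cmult) (auto simp: nn_integral_half_gauss ennreal_mult half_gauss_pos less_imp_le)
  also have "emeasure lborel (ball (0::real^'n) 1) = ennreal (measure lborel (ball (0::real^'n) 1))"
    using emeasure_ball_pos_finite[where 'a="real^'n"] by (simp add: emeasure_eq_ennreal_measure)
  finally show ?thesis unfolding m e_def[symmetric] using half_gauss_pos[of "n + e"] n
    by (simp add: mult.assoc integral_nonneg_AE zero_le_even_power flip: ennreal_mult)
qed

text \<open>Expanded in \<open>c\<close>, the integral in \<open>nn_integral_gauss_cosh\<close> has
  the coefficients \<open>a n / fact n\<close> for even \<open>n\<close>, while its value is
  \<open>exp (c\<^sup>2 / 4) * a 0\<close>. Comparing coefficients gives the ratio of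
  \<open>a (2 * k)\<close> to \<open>a 0\<close>, in which \<open>V\<close> cancels.\<close>

lemma sphere_even_moment:
  fixes v :: "real^'n::finite" and N :: "'n itself"
  assumes v: "norm v = 1"
  shows "half_gauss (2 * k + (CARD('n) - 1)) * (\<integral>\<eta>. (\<eta> \<bullet> v) ^ (2 * k) \<partial>sphere_measure N) = 
    half_gauss (CARD('n) - 1) * fact (2 * k) / (4 ^ k * fact k)"
proof -
  interpret prob_space "sphere_measure N" by (rule prob_space_sphere_measure)
  define V where "V = CARD('n) * measure lborel (ball (0::real^'n) 1)"
  have V: "V > 0" unfolding V_def
    using emeasure_ball_pos_finite[where 'a="real^'n"] by (simp add: measure_def enn2real_positive_iff less_top zero_less_iff_neq_zero)
  define m where "m n = (\<integral>\<eta>. (\<eta> \<bullet> v) ^ n \<partial>sphere_measure N)" for n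
  define a where "a n = V * half_gauss (n + (CARD('n) - 1)) * m n" for n
  have a0: "a n \<ge> 0" if "even n" for n
    unfolding a_def m_def using V half_gauss_pos[of "n + (CARD('n) - 1)"] that
    by (auto simp: zero_le_even_power)
  have M: "(\<integral>\<^sup>+y. ennreal (exp (- (norm y)\<^sup>2) * (y \<bullet> v) ^ n) \<partial>lborel) = ennreal (a n)" if "even n" for n
    using nn_integral_gauss_moment[OF v that, of N] by (simp add: a_def m_def V_def mult_ac)
  have Z: "(\<integral>\<^sup>+y. ennreal (exp (- (norm (y::real^'n))\<^sup>2)) \<partial>lborel) = ennreal (a 0)"
    using M[of 0] by simp
  have s1: "(\<lambda>n. (if even n then a n / fact n else 0) * c ^ n) sums (exp (c\<^sup>2 / 4) * a 0)" for c :: real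
  proof -
    define b where "b n = (if even n then a n / fact n else 0) * c ^ n" for n
    have b0: "b n \<ge> 0" for n unfolding b_def using a0 by (auto simp: zero_le_even_power)
    have "ennreal (exp (c\<^sup>2 / 4) * a 0) = (\<integral>\<^sup>+y. ennreal (exp (- (norm y)\<^sup>2) * cosh (c * (y \<bullet> v))) \<partial>lborel)"
      by (simp only: nn_integral_gauss_cosh[OF v] Z) (simp add: ennreal_mult a0)
    also have "\<dots> = (\<integral>\<^sup>+y. (\<Sum>n. ennreal (exp (- (norm y)\<^sup>2) * (if even n then (c * (y \<bullet> v)) ^ n / fact n else 0))) \<partial>lborel)"
    proof (rule nn_integral_cong)
      fix y :: "real^'n"
      have "(\<lambda>n. if even n then (c * (y \<bullet> v)) ^ n / fact n else 0) sums cosh (c * (y \<bullet> v))"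
        using cosh_converges[of "c * (y \<bullet> v)"] by (simp add: divide_inverse mult.commute cong: if_cong)
      then have "(\<lambda>n. exp (- (norm y)\<^sup>2) * (if even n then (c * (y \<bullet> v)) ^ n / fact n else 0)) sums (exp (- (norm y)\<^sup>2) * cosh (c * (y \<bullet> v)))"
        by (rule sums_mult)
      then show "ennreal (exp (- (norm y)\<^sup>2) * cosh (c * (y \<bullet> v))) = (\<Sum>n. ennreal (exp (- (norm y)\<^sup>2) * (if even n then (c * (y \<bullet> v)) ^ n / fact n else 0)))"
        by (intro suminf_ennreal_eq[symmetric]) (auto simp: zero_le_even_power)
    qed
    \<comment> \<open>This is the reason for cosh: the terms of its series are nonnegative, so sum
      and integral commute without a dominating function.\<close>
    also have "\<dots> = (\<Sum>n. (\<integral>\<^sup>+y. ennreal (exp (- (norm y)\<^sup>2) * (if even n then (c * (y \<bullet> v)) ^ n / fact n else 0)) \<partial>lborel))"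
      by (rule nn_integral_suminf) auto
    also have "\<dots> = (\<Sum>n. ennreal (b n))"
    proof (rule suminf_cong)
      fix n
      show "(\<integral>\<^sup>+y. ennreal (exp (- (norm y)\<^sup>2) * (if even n then (c * (y \<bullet> v)) ^ n / fact n else 0)) \<partial>lborel) = ennreal (b n)"
      proof (cases "even n")
        case True
        then have "(\<integral>\<^sup>+y. ennreal (exp (- (norm y)\<^sup>2) * (if even n then (c * (y \<bullet> v)) ^ n / fact n else 0)) \<partial>lborel)
           = (\<integral>\<^sup>+y. ennreal (c ^ n / fact n) * ennreal (exp (- (norm y)\<^sup>2) * (y \<bullet> v) ^ n) \<partial>lborel)"
          by (intro nn_integral_cong) (simp add: zero_le_even_power power_mult_distrib mult_ac flip: ennreal_mult)
        also have "\<dots> = ennreal (c ^ n / fact n) * ennreal (a n)"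
          unfolding M[OF True, symmetric] by (rule nn_integral_cmult) auto
        finally show ?thesis using True by (simp add: b_def a0 zero_le_even_power mult_ac flip: ennreal_mult)
      qed (simp add: b_def)
    qed
    finally have e: "(\<Sum>n. ennreal (b n)) = ennreal (exp (c\<^sup>2 / 4) * a 0)" ..
    then have "summable b" using b0 by (intro summable_suminf_not_top) auto
    moreover from this have "suminf b = exp (c\<^sup>2 / 4) * a 0"
      using e b0 a0[of 0] by (simp add: suminf_ennreal2 suminf_nonneg)
    ultimately show ?thesis unfolding b_def[abs_def] by (metis summable_sums)
  qed
  have s2: "(\<lambda>n. (if even n then a 0 / (4 ^ (n div 2) * fact (n div 2)) else 0) * c ^ n) sums (exp (c\<^sup>2 / 4) * a 0)" for c :: real
  proof -
    have "(\<lambda>n. (c\<^sup>2 / 4) ^ n /\<^sub>R fact n) sums exp (c\<^sup>2 / 4)" by (rule exp_converges)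
    then have "(\<lambda>n. a 0 * ((c\<^sup>2 / 4) ^ n /\<^sub>R fact n)) sums (a 0 * exp (c\<^sup>2 / 4))" by (rule sums_mult)
    \<comment> \<open>Interleaving with zeros turns the exponential series in
      \<open>c\<^sup>2 / 4\<close> into a power series in \<open>c\<close>.\<close>
    then have "(\<lambda>n. if even n then a 0 * ((c\<^sup>2 / 4) ^ (n div 2) /\<^sub>R fact (n div 2)) else 0) sums (0 + a 0 * exp (c\<^sup>2 / 4))"
      by (rule sums_if[OF sums_zero])
    also have "(\<lambda>n. if even n then a 0 * ((c\<^sup>2 / 4) ^ (n div 2) /\<^sub>R fact (n div 2)) else 0) = 
      (\<lambda>n. (if even n then a 0 / (4 ^ (n div 2) * fact (n div 2)) else 0) * c ^ n)"
      by (auto simp: fun_eq_iff power_divide field_simps simp flip: power_mult)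
    finally show ?thesis by (simp add: mult.commute)
  qed
  define d where "d n = (if even n then a n / fact n else 0) - (if even n then a 0 / (4 ^ (n div 2) * fact (n div 2)) else 0)" for n
  have "d (2 * k) = 0"
  proof (rule powser_zero_imp_coeff_zero)
    show "(\<lambda>n. d n * c ^ n) sums 0" for c
      using sums_diff[OF s1[of c] s2[of c]] unfolding d_def left_diff_distrib by (simp only: diff_self)
  qed
  then have "a (2 * k) / fact (2 * k) = a 0 / (4 ^ k * fact k)" by (simp add: d_def)
  moreover have "m 0 = 1" unfolding m_def by (simp add: prob_space)
  ultimately show ?thesis using V unfolding a_def m_def[symmetric] by (simp add: field_simps)
qed

text \<open>The reflection preserves Lebesgue measure and commutes with \<open>sphere_dir\<close>
  off the origin, a null set.\<close>

lemma nn_integral_sphere_uminus: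
  fixes h :: "real^'n::finite \<Rightarrow> ennreal" and N :: "'n itself"
  assumes [measurable]: "h \<in> borel_measurable borel"
  shows "(\<integral>\<^sup>+\<eta>. h (- \<eta>) \<partial>sphere_measure N) = (\<integral>\<^sup>+\<eta>. h \<eta> \<partial>sphere_measure N)"
proof -
  let ?V = "emeasure lborel (ball (0::real^'n) 1)"
  have [measurable]: "cball (0::real^'n) 1 \<in> sets borel" by simp
  have "(\<integral>\<^sup>+\<eta>. h (- \<eta>) \<partial>sphere_measure N) * ?V = (\<integral>\<^sup>+y. h (- sphere_dir y) * indicator (cball 0 1) y \<partial>lborel)"
    by (rule nn_integral_sphere_measure) measurable
  also have "\<dots> = (\<integral>\<^sup>+y. h (sphere_dir (- y)) * indicator (cball 0 1) (- y) \<partial>lborel)"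
    by (rule nn_integral_cong_AE, rule AE_mp[OF AE_lborel_singleton[of "0::real^'n"]])
       (auto simp: sphere_dir_def sgn_minus indicator_def)
  also have "\<dots> = (\<integral>\<^sup>+y. h (sphere_dir y) * indicator (cball 0 1) y \<partial>lborel)"
    by (subst (2) nn_integral_lborel_scaleR[of _ "-1"]) (auto intro!: borel_measurable_times borel_measurable_indicator)
  also have "\<dots> = (\<integral>\<^sup>+\<eta>. h \<eta> \<partial>sphere_measure N) * ?V"
    by (rule nn_integral_sphere_measure[symmetric]) measurable
  finally show ?thesis using emeasure_ball_pos_finite[where 'a="real^'n"]
    by (simp add: mult.commute[of _ ?V] ennreal_mult_cancel_left)
qed

lemma sphere_odd_moment:
  fixes v :: "real^'n::finite" and N :: "'n itself"
  assumes v: "norm v = 1" and n: "odd n"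
  shows "(\<integral>\<eta>. (\<eta> \<bullet> v) ^ n \<partial>sphere_measure N) = 0"
proof -
  have "integrable (sphere_measure N) (\<lambda>\<eta>. (\<eta> \<bullet> v) ^ n)"
    by (intro sphere_integrable_continuous continuous_intros)
  \<comment> \<open>The integral is the difference of those of the positive and negative parts,
    which the antipodal map exchanges.\<close>
  then show ?thesis
    using nn_integral_sphere_uminus[of "\<lambda>\<eta>. ennreal ((\<eta> \<bullet> v) ^ n)" N] n
    by (simp add: real_lebesgue_integral_def)
qed

text \<open>The recursion of \<open>half_gauss\<close> supplies the factor
  \<open>(2 * k + d + 3) / 2\<close> that \<open>weight_moment_Suc_Suc\<close> absorbs. The
  coefficients are those of \<open>sphere_even_moment\<close>, as \<open>d + 2\<close> is
  \<open>CARD('n) - 1\<close>.\<close>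

lemma weight_moment_even:
  "half_gauss (2 * k + (d + 2)) * weight_moment d (2 * k) = half_gauss (d + 2) * fact (2 * k) / (4 ^ k * fact k) * weight_moment d 0"
proof (induction k)
  case (Suc k)
  have "half_gauss (2 * Suc k + (d + 2)) * weight_moment d (2 * Suc k) = half_gauss (2 * k + (d + 2)) / 2 * ((2 * real k + real d + 3) * weight_moment d (2 * k + 2))"
    by (simp add: field_simps)
  also have "\<dots> = (2 * real k + 1) / 2 * (half_gauss (2 * k + (d + 2)) * weight_moment d (2 * k))"
    unfolding weight_moment_Suc_Suc by simp
  also have "\<dots> = half_gauss (d + 2) * fact (2 * Suc k) / (4 ^ Suc k * fact (Suc k)) * weight_moment d 0"
    unfolding Suc.IH by (simp add: divide_simps) (simp add: algebra_simps)
  finally show ?case .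
qed simp

lemma sphere_moment:
  fixes v :: "real^'n::finite" and N :: "'n itself"
  assumes v: "norm v = 1" and d: "CARD('n) = d + 3"
  shows "(\<integral>\<eta>. (\<eta> \<bullet> v) ^ n \<partial>sphere_measure N) = weight_moment d n / weight_moment d 0"
proof (cases "even n")
  case True
  then obtain k where n: "n = 2 * k" by blast
  define H where "H = half_gauss (2 * k + (d + 2))"
  define H0 where "H0 = half_gauss (d + 2) * fact (2 * k) / (4 ^ k * fact k)"
  have "H * (\<integral>\<eta>. (\<eta> \<bullet> v) ^ n \<partial>sphere_measure N) = H0"
    using sphere_even_moment[OF v, of k N] by (simp add: d n H_def H0_def)
  moreover have "H * weight_moment d n = H0 * weight_moment d 0"
    using weight_moment_even[of k d] by (simp add: n H_def H0_def)
  moreover have "H > 0" "weight_moment d 0 > 0"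
    by (simp_all add: H_def half_gauss_pos weight_moment_0 zonal_int_0_pos)
  ultimately have "H * ((\<integral>\<eta>. (\<eta> \<bullet> v) ^ n \<partial>sphere_measure N) * weight_moment d 0 - weight_moment d n) = 0"
    by (simp add: right_diff_distrib flip: mult.assoc)
  with \<open>H > 0\<close> \<open>weight_moment d 0 > 0\<close> show ?thesis by (simp add: field_simps)
qed (simp add: sphere_odd_moment[OF v] weight_moment_odd)

section \<open>Integrals of zonal functions\<close>

lemma continuous_on_zonal_comp:
  fixes v :: "real^'n::finite"
  assumes "norm v = 1" "continuous_on {-1..1} f"
  shows "continuous_on (sphere 0 1) (\<lambda>\<eta>. f (\<eta> \<bullet> v))"
  using assms abs_inner_sphere_le_1[OF assms(1)]
  by (intro continuous_on_compose2[OF assms(2)] continuous_intros) (auto simp: abs_le_iff)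

text \<open>\<open>I\<close> and \<open>L\<close> agree on polynomials by
  \<open>sphere_moment\<close>. Both are averages, so approximating \<open>f\<close> by a polynomial
  up to \<open>e\<close> changes each by at most \<open>e\<close>.\<close>

lemma integral_zonal:
  fixes v :: "real^'n::finite" and N :: "'n itself" and f :: "real \<Rightarrow> real"
  assumes v: "norm v = 1" and d: "CARD('n) = d + 3" and f: "continuous_on {-1..1} f"
  shows "(\<integral>\<eta>. f (\<eta> \<bullet> v) \<partial>sphere_measure N) = integral {-1..1} (\<lambda>t. f t * sqrt (1 - t\<^sup>2) ^ d) / zonal_int d 0 0"
proof -
  interpret prob_space "sphere_measure N" by (rule prob_space_sphere_measure)
  define W where "W = zonal_int d 0 0"
  have W: "W > 0" by (simp add: W_def zonal_int_0_pos)
  define I where "I f = (\<integral>\<eta>. f (\<eta> \<bullet> v) \<partial>sphere_measure N)" for f :: "real \<Rightarrow> real"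
  define L where "L f = integral {-1..1} (\<lambda>t. f t * sqrt (1 - t\<^sup>2) ^ d) / W" for f :: "real \<Rightarrow> real"
  have int: "integrable (sphere_measure N) (\<lambda>\<eta>. f (\<eta> \<bullet> v))" if "continuous_on {-1..1} f" for f :: "real \<Rightarrow> real"
    by (intro sphere_integrable_continuous continuous_on_zonal_comp v that)
  have "\<bar>I f - L f\<bar> \<le> 2 * e" if e: "e > 0" for e
  proof -
    obtain g where g: "real_polynomial_function g" "\<And>t. t \<in> {-1..1} \<Longrightarrow> \<bar>f t - g t\<bar> < e"
      using Stone_Weierstrass_real_polynomial_function[OF compact_Icc f e] by metis
    obtain a m where gs: "g = (\<lambda>t. \<Sum>i\<le>m. a i * t ^ i)"
      using g(1) by (auto simp: real_polynomial_function_iff_sum)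
    have gc: "continuous_on {-1..1} g" unfolding gs by (intro continuous_intros)
    have "I g = (\<Sum>i\<le>m. a i * (weight_moment d i / W))"
      unfolding I_def gs using sphere_moment[OF v d, where N=N] int[of "\<lambda>t. t ^ _"]
      by (subst Bochner_Integration.integral_sum) (auto simp: W_def weight_moment_0 intro!: continuous_intros int)
    also have "\<dots> = L g"
    proof -
      have "((\<lambda>t. \<Sum>i\<le>m. a i * (t ^ i * sqrt (1 - t\<^sup>2) ^ d)) has_integral (\<Sum>i\<le>m. a i * weight_moment d i)) {-1..1}"
        unfolding weight_moment_def
        by (intro has_integral_sum has_integral_mult_right integrable_integral weight_integrable continuous_intros) auto
      then show ?thesis unfolding L_def gs
        by (simp add: integral_unique sum_distrib_right sum_divide_distrib mult.assoc)
    qed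
    finally have "I g = L g" .
    moreover have "\<bar>I f - I g\<bar> \<le> e"
    proof -
      have "I f - I g = (\<integral>\<eta>. f (\<eta> \<bullet> v) - g (\<eta> \<bullet> v) \<partial>sphere_measure N)"
        unfolding I_def by (rule Bochner_Integration.integral_diff[symmetric]) (intro int f gc)+
      also have "\<bar>\<dots>\<bar> \<le> (\<integral>\<eta>. \<bar>f (\<eta> \<bullet> v) - g (\<eta> \<bullet> v)\<bar> \<partial>sphere_measure N)" by (rule integral_abs_bound)
      also have "\<dots> \<le> (\<integral>\<eta>. e \<partial>sphere_measure N)"
      proof (rule integral_mono)
        show "integrable (sphere_measure N) (\<lambda>\<eta>. \<bar>f (\<eta> \<bullet> v) - g (\<eta> \<bullet> v)\<bar>)"
          by (intro integrable_abs Bochner_Integration.integrable_diff int f gc)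
        fix \<eta> assume "\<eta> \<in> space (sphere_measure N)"
        then have "\<bar>\<eta> \<bullet> v\<bar> \<le> 1" using v by (intro abs_inner_sphere_le_1) (auto simp: space_sphere_measure)
        then have "\<eta> \<bullet> v \<in> {-1..1}" by (simp add: abs_le_iff)
        then show "\<bar>f (\<eta> \<bullet> v) - g (\<eta> \<bullet> v)\<bar> \<le> e" using g(2) by (simp add: less_imp_le)
      qed simp
      also have "\<dots> = e" by (simp add: prob_space)
      finally show ?thesis .
    qed
    moreover have "\<bar>L f - L g\<bar> \<le> e"
    proof -
      have i: "(\<lambda>t. h t * sqrt (1 - t\<^sup>2) ^ d) integrable_on {-1..1}" if "continuous_on {-1..1} h" for h
        using that by (rule weight_integrable)
      have L: "L f - L g = integral {-1..1} (\<lambda>t. f t * sqrt (1 - t\<^sup>2) ^ d - g t * sqrt (1 - t\<^sup>2) ^ d) / W"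
        unfolding L_def by (subst Henstock_Kurzweil_Integration.integral_diff) (auto intro: i f gc simp: diff_divide_distrib)
      have "\<bar>integral {-1..1} (\<lambda>t. f t * sqrt (1 - t\<^sup>2) ^ d - g t * sqrt (1 - t\<^sup>2) ^ d)\<bar> \<le> integral {-1..1} (\<lambda>t. e * sqrt (1 - t\<^sup>2) ^ d)"
      proof (rule integral_norm_bound_integral[where 'a=real, simplified real_norm_def])
        show "(\<lambda>t. f t * sqrt (1 - t\<^sup>2) ^ d - g t * sqrt (1 - t\<^sup>2) ^ d) integrable_on {-1..1}"
          by (intro Henstock_Kurzweil_Integration.integrable_diff i f gc)
        show "(\<lambda>t. e * sqrt (1 - t\<^sup>2) ^ d) integrable_on {-1..1}" by (intro i continuous_intros)
        fix t :: real assume t: "t \<in> {-1..1}"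
        then have "sqrt (1 - t\<^sup>2) ^ d \<ge> 0" by (simp add: abs_square_le_1 abs_le_iff)
        then show "\<bar>f t * sqrt (1 - t\<^sup>2) ^ d - g t * sqrt (1 - t\<^sup>2) ^ d\<bar> \<le> e * sqrt (1 - t\<^sup>2) ^ d"
          using g(2)[OF t] by (simp add: abs_mult mult_right_mono flip: left_diff_distrib)
      qed
      also have "integral {-1..1} (\<lambda>t. e * sqrt (1 - t\<^sup>2) ^ d) = e * W"
        unfolding W_def zonal_int_def by (subst integral_mult_right[symmetric]) (simp add: sq_dist_def)
      finally show ?thesis unfolding L using W by (simp add: pos_divide_le_eq)
    qed
    ultimately show ?thesis by linarith
  qed
  \<comment> \<open>With this \<open>e\<close> a nonzero gap would be at most half of
    itself.\<close>
  from this[of "\<bar>I f - L f\<bar> / 4"] have "I f = L f"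
    by (cases "I f = L f") auto
  then show ?thesis by (simp add: I_def L_def W_def)
qed

section \<open>The sharp estimate\<close>

text \<open>After division by the norms \<open>A\<close> and \<open>B\<close>, Young's inequality
  bounds the product pointwise by \<open>R\<close>, whose integral is 1; the same bound gives
  integrability of the product.\<close>

lemma integral_Holder:
  fixes f g :: "'a \<Rightarrow> real"
  assumes pq: "p > 1" "q > 1" "1 / p + 1 / q = 1"
    and f: "f \<in> borel_measurable M" "\<And>x. 0 \<le> f x" "integrable M (\<lambda>x. f x powr p)"
    and g: "g \<in> borel_measurable M" "\<And>x. 0 \<le> g x" "integrable M (\<lambda>x. g x powr q)"
  shows "(\<integral>x. f x * g x \<partial>M) \<le> (\<integral>x. f x powr p \<partial>M) powr (1 / p) * (\<integral>x. g x powr q \<partial>M) powr (1 / q)"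
proof -
  define A where "A = (\<integral>x. f x powr p \<partial>M) powr (1 / p)"
  define B where "B = (\<integral>x. g x powr q \<partial>M) powr (1 / q)"
  have A: "A \<ge> 0" "A powr p = (\<integral>x. f x powr p \<partial>M)" and B: "B \<ge> 0" "B powr q = (\<integral>x. g x powr q \<partial>M)"
    using pq by (auto simp: A_def B_def powr_powr)
  have zero: "AE x in M. h x = 0" if "(\<integral>x. h x powr r \<partial>M) powr (1 / r) = 0" "integrable M (\<lambda>x. h x powr r)" for h :: "'a \<Rightarrow> real" and r
  proof -
    have "(\<integral>x. h x powr r \<partial>M) = 0" using that(1) by simp
    then have "AE x in M. h x powr r = 0" using that(2) by (subst (asm) integral_nonneg_eq_0_iff_AE) auto
    then show ?thesis by simp
  qed
  show ?thesis
  proof (cases "A = 0 \<or> B = 0")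
    case True
    then have "AE x in M. f x * g x = 0"
      using zero[where h=f and r=p] zero[where h=g and r=q] f(3) g(3) unfolding A_def B_def by auto
    then have "(\<integral>x. f x * g x \<partial>M) = 0" by (rule integral_eq_zero_AE)
    then show ?thesis by (simp flip: A_def B_def add: A B)
  next
    case False
    with A B have AB: "A > 0" "B > 0" by auto
    define R where "R x = f x powr p / (p * A powr p) + g x powr q / (q * B powr q)" for x
    have R: "integrable M R" unfolding R_def[abs_def]
      by (intro Bochner_Integration.integrable_add integrable_divide_zero f g)
    have le: "f x / A * (g x / B) \<le> R x" for x
      using Youngs_inequality[OF pq, of "f x / A" "g x / B"] f(2)[of x] g(2)[of x] AB
      by (simp add: R_def powr_divide mult.commute)
    have int: "integrable M (\<lambda>x. f x / A * (g x / B))"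
      by (rule Bochner_Integration.integrable_bound[OF R])
         (use f(1) g(1) le f(2) g(2) AB in \<open>auto intro!: AE_I2 order.trans[OF _ abs_ge_self] simp: abs_mult\<close>)
    have "(\<integral>x. f x * g x \<partial>M) / (A * B) = (\<integral>x. f x / A * (g x / B) \<partial>M)" by simp
    also have "\<dots> \<le> (\<integral>x. R x \<partial>M)" by (rule integral_mono[OF int R le])
    also have "\<dots> = (\<integral>x. f x powr p \<partial>M) / (p * A powr p) + (\<integral>x. g x powr q \<partial>M) / (q * B powr q)"
      unfolding R_def using f(3) g(3) by simp
    also have "\<dots> = 1 / p + 1 / q" using AB by (simp flip: A(2) B(2))
    finally show ?thesis unfolding pq(3) using AB by (simp add: field_simps flip: A_def B_def)
  qed
qed

section \<open>Riesz means and the best constant at a fixed point\<close>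

lemma sphere_neq_ball: "x \<in> ball 0 1 \<Longrightarrow> norm \<eta> = 1 \<Longrightarrow> x \<noteq> \<eta>"
  by auto

lemma continuous_on_riesz:
  "x \<in> ball 0 1 \<Longrightarrow> continuous_on (sphere 0 1) (\<lambda>\<eta>::real^'n::finite. norm (x - \<eta>) powr a)"
  by (intro continuous_intros) auto

text \<open>Multiplied by \<open>(1 - (norm x)\<^sup>2) powr (s - n + 1)\<close>, this is the T_s of
  the overview.\<close>

definition riesz_mean :: "'n::finite itself \<Rightarrow> real \<Rightarrow> real^'n \<Rightarrow> real" where
  "riesz_mean N s x = (\<integral>\<eta>. norm (x - \<eta>) powr (- s) \<partial>sphere_measure N)"

lemma integrable_riesz:
  "x \<in> ball 0 1 \<Longrightarrow> integrable (sphere_measure (N::'n::finite itself)) (\<lambda>\<eta>. norm (x - \<eta>) powr a)"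
  by (intro sphere_integrable_continuous continuous_on_riesz)

lemma riesz_mean_pos:
  fixes N :: "'n::finite itself"
  assumes x: "x \<in> ball 0 1" and s: "s \<ge> 0"
  shows "riesz_mean N s x > 0"
proof -
  interpret prob_space "sphere_measure N" by (rule prob_space_sphere_measure)
  have "0 < 2 powr (- s)" by simp
  also have "\<dots> = (\<integral>\<eta>. 2 powr (- s) \<partial>sphere_measure N)" by (simp add: prob_space)
  also have "\<dots> \<le> riesz_mean N s x" unfolding riesz_mean_def
  proof (intro integral_mono integrable_riesz x)
    fix \<eta> :: "real^'n" assume "\<eta> \<in> space (sphere_measure N)"
    then have e: "norm \<eta> = 1" by (simp add: space_sphere_measure)
    then have "norm (x - \<eta>) \<le> 2" using x norm_triangle_ineq4[of x \<eta>] by simp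
    moreover have "norm (x - \<eta>) > 0" using sphere_neq_ball[OF x e] by simp
    ultimately show "2 powr (- s) \<le> norm (x - \<eta>) powr (- s)" using s by (intro powr_mono2') auto
  qed simp
  finally show ?thesis .
qed

lemma riesz_mean_eq_zonal_int:
  fixes N :: "'n::finite itself"
  assumes d: "CARD('n) = d + 3" and n: "n = real CARD('n)" and x: "x \<in> ball 0 1"
  shows "riesz_mean N s x = (1 - (norm x)\<^sup>2) powr (- (s - n + 1)) * (zonal_int d (s / 2 - n + 1) (norm x) / zonal_int d 0 0)"
proof (cases "x = 0")
  \<comment> \<open>The centre has no axis \<open>v\<close>, but all distances from it are
    1.\<close>
  case True
  interpret prob_space "sphere_measure N" by (rule prob_space_sphere_measure)
  have "riesz_mean N s x = (\<integral>\<eta>. 1 \<partial>sphere_measure N)"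
    unfolding riesz_mean_def True by (intro Bochner_Integration.integral_cong) (auto simp: space_sphere_measure)
  then show ?thesis using True zonal_int_at_0[of d "s / 2 - n + 1"] zonal_int_0_pos[of d] by (simp add: prob_space)
next
  case False
  define r where "r = norm x"
  have r: "0 < r" "r < 1" using False x by (auto simp: r_def)
  define v where "v = x /\<^sub>R r"
  have v: "norm v = 1" using r by (simp add: v_def r_def)
  have xv: "x = r *\<^sub>R v" using r by (simp add: v_def)
  define \<rho> where "\<rho> = 1 - r\<^sup>2"
  have \<rho>: "\<rho> > 0" using r by (simp add: \<rho>_def abs_square_less_1)
  have "riesz_mean N s x = (\<integral>\<eta>. sq_dist r (\<eta> \<bullet> v) powr (- s / 2) \<partial>sphere_measure N)"
    unfolding riesz_mean_def
  proof (intro Bochner_Integration.integral_cong refl)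
    fix \<eta> :: "real^'n" assume "\<eta> \<in> space (sphere_measure N)"
    then have e: "norm \<eta> = 1" by (simp add: space_sphere_measure)
    have "(norm (x - \<eta>))\<^sup>2 = sq_dist r (\<eta> \<bullet> v)"
      using e v unfolding xv sq_dist_def power2_norm_eq_inner
      by (simp add: algebra_simps norm_eq_1 inner_commute power2_eq_square)
    moreover have "norm (x - \<eta>) powr (- s) = ((norm (x - \<eta>))\<^sup>2) powr (- s / 2)"
      using sphere_neq_ball[OF x e] by (simp add: powr_powr flip: powr_numeral)
    ultimately show "norm (x - \<eta>) powr (- s) = sq_dist r (\<eta> \<bullet> v) powr (- s / 2)" by simp
  qed
  also have "\<dots> = zonal_int d (- s / 2) r / zonal_int d 0 0"
    unfolding zonal_int_def[of d "- s / 2"] using r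
    by (intro integral_zonal[OF v d] continuous_on_sq_dist_powr) auto
  also have "zonal_int d (- s / 2) r = \<rho> powr (- (s - n + 1)) * zonal_int d (s / 2 - n + 1) r"
  proof -
    have "2 * (- s / 2) + real d + 2 = - (s - n + 1)" "- (- s / 2) - (real d + 2) = s / 2 - n + 1"
      using d n by auto
    then show ?thesis using zonal_int_Mobius[OF r, of d "- s / 2"] unfolding \<rho>_def by (simp only:)
  qed
  finally show ?thesis by (simp add: r_def \<rho>_def)
qed

lemma conj_exp_real: "1 < P \<Longrightarrow> conj_exp (ereal P) > 1 \<and> 1 / P + 1 / conj_exp (ereal P) = 1"
  by (simp add: conj_exp_def field_simps)

lemma riesz_Holder:
  fixes N :: "'n::finite itself"
  assumes p: "1 < p" and x: "x \<in> ball 0 1" and \<phi>: "in_Lp N p \<phi>"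
  shows "norm (\<integral>\<eta>. norm (x - \<eta>) powr (- \<beta>) *\<^sub>R \<phi> \<eta> \<partial>sphere_measure N)
    \<le> riesz_mean N (conj_exp p * \<beta>) x powr (1 / conj_exp p) * Lp_norm N p \<phi>"
proof -
  interpret prob_space "sphere_measure N" by (rule prob_space_sphere_measure)
  have [measurable]: "\<phi> \<in> borel_measurable (sphere_measure N)" using \<phi> by (simp add: in_Lp_def)
  have [measurable]: "(\<lambda>\<eta>. norm (x - \<eta>) powr a) \<in> borel_measurable (sphere_measure N)" for a
    by (rule borel_measurable_integrable[OF integrable_riesz[OF x]])
  have "norm (\<integral>\<eta>. norm (x - \<eta>) powr (- \<beta>) *\<^sub>R \<phi> \<eta> \<partial>sphere_measure N)
    \<le> (\<integral>\<eta>. norm (norm (x - \<eta>) powr (- \<beta>) *\<^sub>R \<phi> \<eta>) \<partial>sphere_measure N)"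
    by (rule integral_norm_bound)
  also have "\<dots> = (\<integral>\<eta>. norm (\<phi> \<eta>) * norm (x - \<eta>) powr (- \<beta>) \<partial>sphere_measure N)"
    by (simp add: mult.commute)
  also have "\<dots> \<le> riesz_mean N (conj_exp p * \<beta>) x powr (1 / conj_exp p) * Lp_norm N p \<phi>"
  proof (cases p)
    case (real P)
    then have P: "1 < P" using p by simp
    define q where "q = conj_exp p"
    have q: "q > 1" "1 / P + 1 / q = 1" using conj_exp_real[OF P] by (auto simp: q_def real)
    have "(\<integral>\<eta>. norm (\<phi> \<eta>) * norm (x - \<eta>) powr (- \<beta>) \<partial>sphere_measure N)
      \<le> (\<integral>\<eta>. norm (\<phi> \<eta>) powr P \<partial>sphere_measure N) powr (1 / P)
        * (\<integral>\<eta>. (norm (x - \<eta>) powr (- \<beta>)) powr q \<partial>sphere_measure N) powr (1 / q)"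
      using \<phi> by (intro integral_Holder P q) (auto simp: in_Lp_def real powr_powr intro: integrable_riesz[OF x])
    then show ?thesis using real
      by (simp add: Lp_norm_def riesz_mean_def powr_powr mult_ac q_def)
  next
    case PInf
    define S where "S = esssup (sphere_measure N) (\<lambda>\<eta>. ereal (norm (\<phi> \<eta>)))"
    have AE: "AE \<eta> in sphere_measure N. ereal (norm (\<phi> \<eta>)) \<le> S"
      unfolding S_def by (rule esssup_AE)
    have "S < \<infinity>" using \<phi> PInf by (simp add: in_Lp_def S_def)
    \<comment> \<open>A bound for norms almost everywhere on a probability space cannot be negative;
      this rules out minus infinity.\<close>
    moreover have "S \<ge> 0"
    proof -
      have "AE \<eta> in sphere_measure N. 0 \<le> S" using AE by eventually_elim (auto intro: order.trans[rotated])
      then show ?thesis by simp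
    qed
    ultimately obtain s where s: "S = ereal s" and s0: "s \<ge> 0" by (cases S) auto
    have "(\<integral>\<eta>. norm (\<phi> \<eta>) * norm (x - \<eta>) powr (- \<beta>) \<partial>sphere_measure N)
      \<le> (\<integral>\<eta>. s * norm (x - \<eta>) powr (- \<beta>) \<partial>sphere_measure N)"
    proof (rule integral_mono_AE)
      show i: "integrable (sphere_measure N) (\<lambda>\<eta>. s * norm (x - \<eta>) powr (- \<beta>))"
        by (intro integrable_mult_right integrable_riesz x)
      show *: "AE \<eta> in sphere_measure N. norm (\<phi> \<eta>) * norm (x - \<eta>) powr (- \<beta>) \<le> s * norm (x - \<eta>) powr (- \<beta>)"
        using AE unfolding s by eventually_elim (simp add: mult_right_mono)
      show "integrable (sphere_measure N) (\<lambda>\<eta>. norm (\<phi> \<eta>) * norm (x - \<eta>) powr (- \<beta>))"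
        by (rule Bochner_Integration.integrable_bound[OF i])
           (use * s0 in \<open>auto elim!: eventually_mono simp: abs_mult\<close>)
    qed
    also have "\<dots> = s * riesz_mean N \<beta> x" by (simp add: riesz_mean_def)
    finally show ?thesis
      using PInf by (simp add: conj_exp_def Lp_norm_def s mult.commute riesz_mean_def flip: S_def)
  qed (use p in simp)
  finally show ?thesis .
qed

text \<open>Equality in Hoelder's inequality holds if \<open>norm (\<phi> \<eta>) powr p\<close> is
  proportional to \<open>norm (x - \<eta>) powr (- (q * \<beta>))\<close>, and a constant direction
  \<open>e\<close> loses nothing when the norm enters the integral. For infinite \<open>p\<close>
  the constant field \<open>e\<close> will do.\<close>

lemma riesz_extremal:
  fixes N :: "'n::finite itself"
  assumes p: "1 < p" and x: "x \<in> ball 0 1" and \<beta>: "\<beta> \<ge> 0"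
  obtains \<phi> where "in_Lp N p \<phi>" "Lp_norm N p \<phi> > 0"
    "norm (\<integral>\<eta>. norm (x - \<eta>) powr (- \<beta>) *\<^sub>R \<phi> \<eta> \<partial>sphere_measure N)
      = riesz_mean N (conj_exp p * \<beta>) x powr (1 / conj_exp p) * Lp_norm N p \<phi>"
proof -
  interpret prob_space "sphere_measure N" by (rule prob_space_sphere_measure)
  define e :: "real^'n" where "e = (SOME b. b \<in> Basis)"
  have e: "norm e = 1" by (simp add: e_def SOME_Basis)
  show ?thesis
  proof (cases p)
    case (real P)
    then have P: "1 < P" using p by simp
    define q where "q = conj_exp p"
    have q: "q > 1" "1 / P + 1 / q = 1" using conj_exp_real[OF P] by (auto simp: q_def real)
    have qP: "(q - 1) * P = q" using q P by (simp add: field_simps)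
    define I where "I = riesz_mean N (q * \<beta>) x"
    have I: "I > 0" unfolding I_def using q \<beta> by (intro riesz_mean_pos x) auto
    \<comment> \<open>The exponent is \<open>q * \<beta> / P\<close>, rewritten by
      \<open>qP\<close>.\<close>
    define \<phi> where "\<phi> \<eta> = norm (x - \<eta>) powr (- (\<beta> * (q - 1))) *\<^sub>R e" for \<eta>
    have pw: "norm (\<phi> \<eta>) powr P = norm (x - \<eta>) powr (- (q * \<beta>))" for \<eta>
    proof -
      have *: "- (\<beta> * (q - 1)) * P = - (q * \<beta>)"
        by (simp only: mult_minus_left mult.assoc qP) (simp add: mult.commute)
      have "norm (\<phi> \<eta>) = norm (x - \<eta>) powr (- (\<beta> * (q - 1)))" by (simp add: \<phi>_def e)
      then show ?thesis by (simp only: powr_powr *)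
    qed
    show ?thesis
    proof (rule that[of \<phi>])
      show "in_Lp N p \<phi>"
      proof -
        have [measurable]: "(\<lambda>\<eta>. norm (x - \<eta>) powr (- (\<beta> * (q - 1)))) \<in> borel_measurable (sphere_measure N)"
          by (rule borel_measurable_integrable[OF integrable_riesz[OF x]])
        have "\<phi> \<in> borel_measurable (sphere_measure N)"
          unfolding \<phi>_def[abs_def] by measurable
        then show ?thesis by (simp add: in_Lp_def real pw integrable_riesz[OF x])
      qed
      have L: "Lp_norm N p \<phi> = I powr (1 / P)"
        unfolding Lp_norm_def real by (simp add: pw I_def riesz_mean_def)
      then show "Lp_norm N p \<phi> > 0" using I by simp
      have "norm (x - \<eta>) powr (- \<beta>) *\<^sub>R \<phi> \<eta> = norm (x - \<eta>) powr (- (q * \<beta>)) *\<^sub>R e" for \<eta>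
      proof -
        have "- \<beta> + - (\<beta> * (q - 1)) = - (q * \<beta>)" by (simp add: algebra_simps)
        then show ?thesis by (simp add: \<phi>_def flip: powr_add)
      qed
      then have "(\<integral>\<eta>. norm (x - \<eta>) powr (- \<beta>) *\<^sub>R \<phi> \<eta> \<partial>sphere_measure N) = I *\<^sub>R e"
        using integrable_riesz[OF x] by (simp add: I_def riesz_mean_def)
      \<comment> \<open>The exponent 1 is split so that the second factor is the norm of
        \<open>\<phi>\<close>.\<close>
      then have "norm (\<integral>\<eta>. norm (x - \<eta>) powr (- \<beta>) *\<^sub>R \<phi> \<eta> \<partial>sphere_measure N) = I powr (1 / q + 1 / P)"
        using I e q(2) by (simp add: add.commute)
      also have "\<dots> = I powr (1 / q) * I powr (1 / P)" by (rule powr_add)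
      finally show "norm (\<integral>\<eta>. norm (x - \<eta>) powr (- \<beta>) *\<^sub>R \<phi> \<eta> \<partial>sphere_measure N)
        = riesz_mean N (conj_exp p * \<beta>) x powr (1 / conj_exp p) * Lp_norm N p \<phi>"
        unfolding L by (simp flip: q_def I_def)
    qed
  next
    case PInf
    have ess: "esssup (sphere_measure N) (\<lambda>\<eta>. ereal (norm e)) = 1"
      by (subst esssup_const) (auto simp: e emeasure_space_1)
    show ?thesis
    proof (rule that[of "\<lambda>_. e"])
      show "in_Lp N p (\<lambda>_. e)" using ess PInf by (simp add: in_Lp_def)
      have L: "Lp_norm N p (\<lambda>_. e) = 1" using ess PInf by (simp add: Lp_norm_def)
      then show "Lp_norm N p (\<lambda>_. e) > 0" by simp
      have "(\<integral>\<eta>. norm (x - \<eta>) powr (- \<beta>) *\<^sub>R e \<partial>sphere_measure N) = riesz_mean N \<beta> x *\<^sub>R e"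
        using integrable_riesz[OF x] by (simp add: riesz_mean_def)
      then show "norm (\<integral>\<eta>. norm (x - \<eta>) powr (- \<beta>) *\<^sub>R e \<partial>sphere_measure N)
        = riesz_mean N (conj_exp p * \<beta>) x powr (1 / conj_exp p) * Lp_norm N p (\<lambda>_. e)"
        unfolding L using PInf e riesz_mean_pos[OF x \<beta>, of N] by (simp add: conj_exp_def)
    qed
  qed (use p in simp)
qed

section \<open>Assembling the constant\<close>

lemma u_ab_eq:
  "u_ab (N::'n::finite itself) \<alpha> \<beta> \<phi> x = (c_const (real CARD('n)) \<beta> * (1 - (norm x)\<^sup>2) powr \<alpha>) *\<^sub>R
     (\<integral>\<eta>. norm (x - \<eta>) powr (- \<beta>) *\<^sub>R \<phi> \<eta> \<partial>sphere_measure N)"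
  by (simp add: u_ab_def powr_minus divide_inverse flip: integral_scaleR_right scaleR_scaleR)

lemma conj_exp_inv_exp:
  assumes "1 < p" shows "conj_exp p \<ge> 1" "inv_exp p = 1 - 1 / conj_exp p"
proof -
  show "conj_exp p \<ge> 1" using assms conj_exp_real by (cases p) (auto simp: less_imp_le conj_exp_def)
  show "inv_exp p = 1 - 1 / conj_exp p"
  proof (cases p)
    case (real P)
    then have "1 / P + 1 / conj_exp p = 1" using assms conj_exp_real[of P] by simp
    then show ?thesis using real by (simp add: inv_exp_def)
  qed (use assms in \<open>auto simp: inv_exp_def conj_exp_def\<close>)
qed

text \<open>The test \<open>q \<le> 2*(n-1)/\<beta>\<close> amounts to \<open>k \<le> 0\<close>, and
  the Gamma quotient is the boundary value from \<open>zonal_int_ratio\<close>.\<close>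

lemma C_p_eq:
  assumes n: "n = real d + 3" and \<beta>: "n \<le> \<beta>" and q: "q \<ge> 1"
  defines "k \<equiv> q * \<beta> / 2 - n + 1"
  shows "C_p n \<beta> q = c_const n \<beta> * (if k \<le> 0 then 1 else zonal_int d k 1 / zonal_int d 0 0) powr (1 / q)"
proof (cases "n \<le> \<beta> \<and> \<beta> < 2*(n-1) \<and> q \<le> 2*(n-1)/\<beta>")
  case True
  then have "k \<le> 0" using \<beta> n by (simp add: k_def field_simps)
  then show ?thesis using True by (simp add: C_p_def)
next
  case False
  have b: "\<beta> > 0" using \<beta> n by simp
  have ge: "q * \<beta> \<ge> 2 * (n - 1)"
  proof (cases "\<beta> < 2 * (n - 1)")
    case True
    then show ?thesis using False \<beta> b by (simp add: field_simps)
  next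
    case False
    moreover have "1 * \<beta> \<le> q * \<beta>" using q b by (intro mult_right_mono) auto
    ultimately show ?thesis by simp
  qed
  \<comment> \<open>The Gamma branch includes \<open>k = 0\<close>, for \<open>q = 1\<close> and
    \<open>\<beta> = 2*(n-1)\<close>; there the ratio is 1.\<close>
  have "k \<le> 0 \<Longrightarrow> zonal_int d k 1 / zonal_int d 0 0 = 1"
  proof -
    assume "k \<le> 0"
    with ge have "k = 0" by (simp add: k_def)
    then show ?thesis using zonal_int_0_pos[of d] by (simp add: zonal_int_0_at_1)
  qed
  then have "(if k \<le> 0 then 1 else zonal_int d k 1 / zonal_int d 0 0) = zonal_int d k 1 / zonal_int d 0 0" by (cases "k \<le> 0") (simp_all only: if_True if_False)
  also have "\<dots> = Gamma (n/2) * Gamma (q*\<beta> - n + 1) / (Gamma (q*\<beta>/2) * Gamma ((q*\<beta> - n + 2)/2))"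
    unfolding k_def by (rule zonal_int_ratio[OF n ge])
  finally show ?thesis unfolding C_p_def if_not_P[OF False] by simp
qed

theorem theorem1p4:
  fixes N :: "'n::finite itself" and p :: ereal and \<alpha> \<beta> :: real
  assumes "CARD('n) \<ge> 3"
    and "1 < p"
    and "\<beta> > 0"
    and "real CARD('n) + \<alpha> = \<beta> + 1"
    and "real CARD('n) \<le> \<beta>"
  shows "bound_holds N \<alpha> \<beta> p (C_p (real CARD('n)) \<beta> (conj_exp p))
    \<and> (\<forall>C. bound_holds N \<alpha> \<beta> p C \<longrightarrow> C_p (real CARD('n)) \<beta> (conj_exp p) \<le> C)"
proof -
  obtain d where d: "CARD('n) = d + 3" using assms(1) by (metis add.commute le_Suc_ex)
  define n where "n = real CARD('n)"
  have n: "n = real d + 3" by (simp add: n_def d)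
  define q where "q = conj_exp p"
  have q: "q \<ge> 1" and ip: "inv_exp p = 1 - 1 / q" using conj_exp_inv_exp[OF assms(2)] by (auto simp: q_def)
  have \<beta>: "n \<le> \<beta>" using assms(5) by (simp add: n_def)
  have \<alpha>: "\<alpha> = \<beta> + 1 - n" using assms(4) by (simp add: n_def)
  define c where "c = c_const n \<beta>"
  have "0 < \<beta> / 2" "0 < \<beta> / 2 - n / 2 + 1" "0 < n / 2" "0 < \<beta> - n + 1"
    using \<beta> n by linarith+
  then have c: "c > 0" unfolding c_def c_const_def
    by (simp only: divide_pos_pos mult_pos_pos Gamma_real_pos)
  define k where "k = q * \<beta> / 2 - n + 1"
  define T where "T r = zonal_int d k r / zonal_int d 0 0" for r
  define M where "M = (if k \<le> 0 then 1 else T 1)"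
  have Cp: "C_p n \<beta> q = c * M powr (1 / q)"
    unfolding M_def T_def k_def c_def by (rule C_p_eq[OF n \<beta> q])
  have W: "zonal_int d 0 0 > 0" by (rule zonal_int_0_pos)
  \<comment> \<open>\<open>q \<ge> 1\<close> and \<open>\<beta> \<ge> n\<close> give
    \<open>q * \<beta> \<ge> n\<close>, the range in which \<open>zonal_int_ineq\<close>
    applies.\<close>
  have k: "- (real d + 1) / 2 \<le> k"
  proof -
    have "1 * \<beta> \<le> q * \<beta>" using q \<beta> n by (intro mult_right_mono) auto
    then have "n / 2 \<le> q * \<beta> / 2" using \<beta> by simp
    then show ?thesis using n unfolding k_def by (simp add: field_simps)
  qed
  have TM: "T r \<le> M" if "0 \<le> r" "r < 1" for r
  proof (cases "k \<le> 0")
    case True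
    then show ?thesis using zonal_int_antimono[OF k True that] W by (simp add: T_def M_def)
  next
    case False
    then show ?thesis using zonal_int_le_1[of k r d] that W by (simp add: T_def M_def divide_right_mono)
  qed
  have \<rho>: "1 - (norm x)\<^sup>2 > 0" if "x \<in> ball 0 1" for x :: "real^'n"
    using that by (simp add: abs_square_less_1)
  have rm: "(1 - (norm x)\<^sup>2) powr \<alpha> * riesz_mean N (q * \<beta>) x powr (1 / q) = T (norm x) powr (1 / q) / (1 - (norm x)\<^sup>2) powr ((n - 1) * inv_exp p)"
    and Tpos: "T (norm x) > 0"
    if x: "x \<in> ball 0 1" for x :: "real^'n"
  proof -
    define \<rho> where "\<rho> = 1 - (norm x)\<^sup>2"
    have \<rho>: "\<rho> > 0" using \<rho>[OF x] by (simp add: \<rho>_def)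
    have rme: "riesz_mean N (q * \<beta>) x = \<rho> powr (- (q * \<beta> - n + 1)) * T (norm x)"
      unfolding \<rho>_def T_def k_def by (rule riesz_mean_eq_zonal_int[OF d n_def x])
    moreover have "riesz_mean N (q * \<beta>) x > 0" using q \<beta> n by (intro riesz_mean_pos x) auto
    ultimately show T: "T (norm x) > 0" using \<rho> by (simp add: zero_less_mult_iff)
    have "\<rho> powr \<alpha> * riesz_mean N (q * \<beta>) x powr (1 / q) = \<rho> powr (\<alpha> + - (q * \<beta> - n + 1) * (1 / q)) * T (norm x) powr (1 / q)"
      unfolding rme using \<rho> T by (simp add: powr_mult powr_powr powr_add)
    \<comment> \<open>As \<open>\<alpha> = \<beta> + 1 - n\<close>, the terms in
      \<open>\<beta>\<close> cancel and \<open>- (n - 1) * (1 - 1 / q)\<close> remains.\<close>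
    also have "\<alpha> + - (q * \<beta> - n + 1) * (1 / q) = - ((n - 1) * inv_exp p)"
      using q by (simp add: \<alpha> ip field_simps)
    finally show "(1 - (norm x)\<^sup>2) powr \<alpha> * riesz_mean N (q * \<beta>) x powr (1 / q) = T (norm x) powr (1 / q) / (1 - (norm x)\<^sup>2) powr ((n - 1) * inv_exp p)"
      by (simp add: \<rho>_def powr_minus_divide)
  qed
  have upper: "bound_holds N \<alpha> \<beta> p (C_p n \<beta> q)"
    unfolding bound_holds_def
  proof (intro ballI allI impI)
    fix x :: "real^'n" and \<phi> assume x: "x \<in> ball 0 1" and \<phi>: "in_Lp N p \<phi>"
    define R where "R = (1 - (norm x)\<^sup>2) powr ((n - 1) * inv_exp p)"
    have R: "R > 0" using \<rho>[OF x] by (simp add: R_def)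
    \<comment> \<open>Read off from Hoelder's inequality, which treats finite and infinite
      \<open>p\<close> alike.\<close>
    have L0: "Lp_norm N p \<phi> \<ge> 0"
    proof -
      have "0 \<le> riesz_mean N (q * \<beta>) x powr (1 / q) * Lp_norm N p \<phi>"
        using riesz_Holder[OF assms(2) x \<phi>, of \<beta>] unfolding q_def by (rule order.trans[OF norm_ge_zero])
      moreover have "riesz_mean N (q * \<beta>) x > 0" using q \<beta> n by (intro riesz_mean_pos x) auto
      ultimately show ?thesis by (simp add: zero_le_mult_iff)
    qed
    have "norm (u_ab N \<alpha> \<beta> \<phi> x) = c * (1 - (norm x)\<^sup>2) powr \<alpha> * norm (\<integral>\<eta>. norm (x - \<eta>) powr (- \<beta>) *\<^sub>R \<phi> \<eta> \<partial>sphere_measure N)"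
      unfolding u_ab_eq using c by (simp add: n_def c_def abs_mult)
    also have "\<dots> \<le> c * (1 - (norm x)\<^sup>2) powr \<alpha> * (riesz_mean N (q * \<beta>) x powr (1 / q) * Lp_norm N p \<phi>)"
      using c riesz_Holder[OF assms(2) x \<phi>, of \<beta>] unfolding q_def by (intro mult_left_mono) auto
    also have "\<dots> = c * (T (norm x) powr (1 / q) / R) * Lp_norm N p \<phi>"
      unfolding R_def rm[OF x, symmetric] by (simp add: mult_ac)
    also have "\<dots> \<le> c * (M powr (1 / q) / R) * Lp_norm N p \<phi>"
      using c R L0 Tpos[OF x] TM[of "norm x"] x q
      by (intro mult_right_mono mult_left_mono divide_right_mono powr_mono2) auto
    finally show "norm (u_ab N \<alpha> \<beta> \<phi> x) \<le> C_p n \<beta> q / (1 - (norm x)\<^sup>2) powr ((real CARD('n) - 1) * inv_exp p) * Lp_norm N p \<phi>"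
      unfolding Cp R_def n_def[symmetric] by simp
  qed
  have lower: "C_p n \<beta> q \<le> C" if C: "bound_holds N \<alpha> \<beta> p C" for C
  proof -
    \<comment> \<open>The extremal field for this \<open>x\<close> tests the assumed bound; the
      factors \<open>1 / R\<close> and \<open>Lp_norm N p \<phi>\<close> then cancel.\<close>
    have le: "c * T (norm x) powr (1 / q) \<le> C" if x: "x \<in> ball 0 1" for x :: "real^'n"
    proof -
      define R where "R = (1 - (norm x)\<^sup>2) powr ((n - 1) * inv_exp p)"
      have R: "R > 0" using \<rho>[OF x] by (simp add: R_def)
      obtain \<phi> where \<phi>: "in_Lp N p \<phi>" "Lp_norm N p \<phi> > 0"
        "norm (\<integral>\<eta>. norm (x - \<eta>) powr (- \<beta>) *\<^sub>R \<phi> \<eta> \<partial>sphere_measure N)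
          = riesz_mean N (q * \<beta>) x powr (1 / q) * Lp_norm N p \<phi>"
        using riesz_extremal[OF assms(2) x, of \<beta> N] assms(3) unfolding q_def by auto
      have "norm (u_ab N \<alpha> \<beta> \<phi> x) = c * (1 - (norm x)\<^sup>2) powr \<alpha> * (riesz_mean N (q * \<beta>) x powr (1 / q) * Lp_norm N p \<phi>)"
        unfolding u_ab_eq norm_scaleR \<phi>(3) using c by (simp add: n_def c_def abs_mult)
      also have "\<dots> = c * (T (norm x) powr (1 / q) / R) * Lp_norm N p \<phi>"
        unfolding R_def rm[OF x, symmetric] by (simp add: mult_ac)
      finally have "c * (T (norm x) powr (1 / q) / R) * Lp_norm N p \<phi> \<le> C / R * Lp_norm N p \<phi>"
        using C x \<phi>(1) unfolding bound_holds_def R_def n_def by fastforce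
      then show ?thesis using \<phi>(2) R by (simp add: divide_le_cancel)
    qed
    have le': "c * T r powr (1 / q) \<le> C" if "0 \<le> r" "r < 1" for r
      using le[of "r *\<^sub>R (SOME b. b \<in> Basis)"] that by (simp add: SOME_Basis)
    show ?thesis
    proof (cases "k \<le> 0")
      case True
      \<comment> \<open>Here \<open>M\<close> is the value at the centre.\<close>
      then show ?thesis using le'[of 0] W zonal_int_at_0[of d k] by (simp add: Cp M_def T_def)
    next
      case False
      have "continuous_on {0..1} T"
        unfolding T_def[abs_def] using False W by (intro continuous_intros continuous_on_zonal_int') auto
      moreover have "T r \<ge> 0" for r
        unfolding T_def using W by (intro divide_nonneg_pos zonal_int_nonneg) auto
      \<comment> \<open>Here \<open>M\<close> is the value at the boundary, outside the ball, so the
        bound passes from \<open>{0..<1}\<close> to its closure.\<close>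
      ultimately have cont: "continuous_on (closure {0..<1}) (\<lambda>r. c * T r powr (1 / q))"
        using q by (intro continuous_on_mult continuous_on_const continuous_on_powr') auto
      have "c * T 1 powr (1 / q) \<le> C"
        by (rule continuous_le_on_closure[OF cont]) (auto intro: le')
      then show ?thesis using False by (simp add: Cp M_def)
    qed
  qed
  show ?thesis using upper lower unfolding n_def q_def by blast
qed

end
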